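(* Let $\mathbf{X}$ be an $n\times n$ real symmetric matrix. The following hold. (1) Let $2\le k\le n$. If all $k\times k$ principal submatrices of $\mathbf{X}$ are of rank $1$ and positive semidefinite, then $\mathbf{X}$ spans an extreme ray of $\mathcal{S}^{n,k}_+$. (2) Let $n\ge 2$. $\mathbf{X}$ spans an extreme ray of $\mathcal{S}^{n,2}_+$ if and only if all $2\times 2$ principal submatrices of $\mathbf{X}$ are of rank $1$ and positive semidefinite. (3) Let $n\ge 3$. $\mathbf{X}$ spans an extreme ray of $\mathcal{S}^{n,n-1}_+$ if and only if all $(n-1)\times(n-1)$ principal submatrices of $\mathbf{X}$ are positive semidefinite and one of the following holds: (a) all $(n-1)\times(n-1)$ principal submatrices of $\mathbf{X}$ have rank $1$; or (b) all $(n-1)\times(n-1)$ principal submatrices of $\mathbf{X}$ have rank $n-2$, and $\det(\mathbf{X})<0$.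
   Context: For integers $2\le k\le n$, the $k$-PSD closure $\mathcal{S}^{n,k}_+$ is the convex cone of all $n\times n$ real symmetric matrices all of whose $k\times k$ principal submatrices (submatrices with rows and columns indexed by the same $k$-element subset of $\{1,\dots,n\}$) are positive semidefinite. A matrix $\mathbf{X}$ spans an extreme ray of a convex cone $K$ if $\mathbf{X}\in K$, $\mathbf{X}\ne\mathbf{0}$, and whenever $\mathbf{X}=\mathbf{Y}+\mathbf{Z}$ with $\mathbf{Y},\mathbf{Z}\in K$, both $\mathbf{Y}$ and $\mathbf{Z}$ are nonnegative scalar multiples of $\mathbf{X}$.
   Formalization: In (2) and (3a), "all principal submatrices have rank 1" is read as "X is nonzero and all of them have rank at most 1"; literally, "only if" fails for n ≥ 3, e.g. X = e1 e1^T is extreme but has zero principal submatrices. *)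

theory Defs
  imports "Jordan_Normal_Form.DL_Rank_Submatrix"
begin

definition sym_mat :: "nat \<Rightarrow> real mat \<Rightarrow> bool" where
  "sym_mat n A \<longleftrightarrow> A \<in> carrier_mat n n \<and> A\<^sup>T = A"

definition psd_mat :: "nat \<Rightarrow> real mat \<Rightarrow> bool" where
  "psd_mat n A \<longleftrightarrow> sym_mat n A \<and> (\<forall>v \<in> carrier_vec n. 0 \<le> v \<bullet> (A *\<^sub>v v))"

(* Matrix rows and columns are numbered from 0, so the full index set is {..<n}. *)
definition principal_submatrices :: "nat \<Rightarrow> nat \<Rightarrow> real mat \<Rightarrow> real mat set" where
  "principal_submatrices n k A = {submatrix A I I | I. I \<subseteq> {..<n} \<and> card I = k}"

definition k_psd_closure :: "nat \<Rightarrow> nat \<Rightarrow> real mat set" where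
  "k_psd_closure n k = {A. sym_mat n A \<and> (\<forall>B \<in> principal_submatrices n k A. psd_mat k B)}"

definition spans_extreme_ray :: "nat \<Rightarrow> real mat set \<Rightarrow> real mat \<Rightarrow> bool" where
  "spans_extreme_ray n K X \<longleftrightarrow> X \<in> K \<and> X \<noteq> 0\<^sub>m n n \<and>
     (\<forall>Y \<in> K. \<forall>Z \<in> K. X = Y + Z \<longrightarrow>
        (\<exists>a \<ge> 0. Y = a \<cdot>\<^sub>m X) \<and> (\<exists>b \<ge> 0. Z = b \<cdot>\<^sub>m X))"

end

theory Submission
  imports Defs
begin

text \<open>
  A matrix lies in the closure of order \<open>k\<close> exactly when its quadratic form is nonnegative on all
  vectors supported on \<open>k\<close> coordinates, and the whole argument is about that form.

  Suppose first that all principal submatrices of order \<open>k\<close> have rank at most one. Then all principal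
  minors of order two vanish, and any summand of \<open>X\<close> in the closure must be proportional to \<open>X\<close>
  on each pair of indices, because the form of both summands vanishes on the kernel of a singular
  two-by-two block. A positive diagonal entry makes the factors agree
  (\<open>rank_one_minors_imp_extreme\<close>). For order two the converse holds since an entry whose minor is
  strictly positive can be perturbed in both directions (\<open>extreme_2_imp_minors\<close>).

  For order \<open>n - 1\<close> the condition is nonnegativity on every coordinate hyperplane. Let \<open>X\<close> be
  extreme and let \<open>u\<close> be its column \<open>i\<close>. Whenever \<open>(u \<bullet> x)\<^sup>2\<close> is bounded by a multiple of the
  form on these hyperplanes, a multiple of \<open>u u\<^sup>T\<close> can be split off, and extremality makes
  \<open>u u\<^sup>T\<close> a multiple of \<open>X\<close> (\<open>extreme_column_bound\<close>). By Cauchy--Schwarz this applies if \<open>X\<close> is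
  semidefinite, and then \<open>X\<close> has rank one. If \<open>X\<close> is not semidefinite, the bound must fail for
  every column; but it would hold if \<open>X\<close> were singular or if some principal submatrix of order
  \<open>n - 1\<close> were nonsingular (\<open>extreme_not_psd_imp_singular_principal\<close>). So \<open>X\<close> is nonsingular with
  singular principal submatrices, which gives them rank \<open>n - 2\<close>
  (\<open>rank_singular_principal_submatrix\<close>). The form is semidefinite on a hyperplane and negative
  somewhere, so its determinant is negative (\<open>det_nonpos_if_negative_direction\<close>).

  Conversely, if these submatrices are singular and \<open>det X < 0\<close>, their kernels supply the columns
  of the inverse of \<open>X\<close> as isotropic vectors. They are isotropic for every summand too, which
  makes the summand a column scaling of \<open>X\<close>; symmetry and the indecomposability of \<open>X\<close> make the
  scaling constant (\<open>singular_principals_imp_extreme\<close>).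
\<close>

section \<open>Bilinear forms over coordinate functions\<close>

text \<open>Vectors are functions on the naturals of which only the values below \<open>n\<close> matter. A vector
  supported on an index set and a vector of smaller dimension then have the same type, which
  avoids carrier side conditions in all computations with quadratic forms.\<close>

definition mulv :: "nat \<Rightarrow> real mat \<Rightarrow> (nat \<Rightarrow> real) \<Rightarrow> nat \<Rightarrow> real" where
  "mulv n A x i = (\<Sum>j<n. A $$ (i, j) * x j)"

definition bil :: "nat \<Rightarrow> real mat \<Rightarrow> (nat \<Rightarrow> real) \<Rightarrow> (nat \<Rightarrow> real) \<Rightarrow> real" where
  "bil n A x y = (\<Sum>i<n. x i * mulv n A y i)"

definition unit_fun :: "nat \<Rightarrow> nat \<Rightarrow> real" where
  "unit_fun i j = (if j = i then 1 else 0)"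

text \<open>Nonnegativity of the quadratic form on the coordinate subspace indexed by \<open>I\<close>; by
  \<open>psd_mat_submatrix_iff\<close> this is semidefiniteness of the principal submatrix on \<open>I\<close>.\<close>

definition psd_on :: "nat \<Rightarrow> nat set \<Rightarrow> real mat \<Rightarrow> bool" where
  "psd_on n I A \<longleftrightarrow> (\<forall>x. (\<forall>i<n. i \<notin> I \<longrightarrow> x i = 0) \<longrightarrow> 0 \<le> bil n A x x)"

lemma sym_mat_carrier: "sym_mat n A \<Longrightarrow> A \<in> carrier_mat n n"
  by (simp add: sym_mat_def)

lemma sym_mat_index:
  assumes "sym_mat n A" "i < n" "j < n"
  shows "A $$ (i, j) = A $$ (j, i)"
  using assms unfolding sym_mat_def
  by (metis carrier_matD(1) carrier_matD(2) index_transpose_mat(1))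

lemma sym_matI:
  assumes "A \<in> carrier_mat n n" "\<And>i j. i < n \<Longrightarrow> j < n \<Longrightarrow> A $$ (i, j) = A $$ (j, i)"
  shows "sym_mat n A"
  unfolding sym_mat_def using assms by (auto intro!: eq_matI)

lemma mulv_unit: "j < n \<Longrightarrow> mulv n A (unit_fun j) i = A $$ (i, j)"
  by (simp add: mulv_def unit_fun_def if_distrib cong: if_cong)

lemma bil_unit_left: "i < n \<Longrightarrow> bil n A (unit_fun i) y = mulv n A y i"
  by (simp add: bil_def unit_fun_def if_distrib[of "\<lambda>c. c * _"] cong: if_cong)

lemma mulv_lincomb:
  "mulv n A (\<lambda>i. c * x i + d * y i) i = c * mulv n A x i + d * mulv n A y i"
  by (simp add: mulv_def sum.distrib sum_distrib_left algebra_simps)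

lemma bil_lincomb_left:
  "bil n A (\<lambda>i. c * x i + d * y i) z = c * bil n A x z + d * bil n A y z"
  by (simp add: bil_def sum.distrib sum_distrib_left algebra_simps)

lemma bil_lincomb_right:
  "bil n A z (\<lambda>i. c * x i + d * y i) = c * bil n A z x + d * bil n A z y"
  by (simp add: bil_def mulv_lincomb sum.distrib sum_distrib_left algebra_simps)

lemma bil_sym:
  assumes "sym_mat n A"
  shows "bil n A x y = bil n A y x"
proof -
  have "bil n A x y = (\<Sum>i<n. \<Sum>j<n. x i * (A $$ (i, j) * y j))"
    by (simp add: bil_def mulv_def sum_distrib_left)
  also have "\<dots> = (\<Sum>j<n. \<Sum>i<n. x i * (A $$ (i, j) * y j))"
    by (rule sum.swap)
  also have "\<dots> = (\<Sum>j<n. \<Sum>i<n. y j * (A $$ (j, i) * x i))"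
    by (intro sum.cong refl) (use sym_mat_index[OF assms] in auto)
  finally show ?thesis by (simp add: bil_def mulv_def sum_distrib_left)
qed

lemma bil_unit_right:
  assumes "sym_mat n A" "i < n"
  shows "bil n A y (unit_fun i) = mulv n A y i"
  using assms by (simp add: bil_sym[of n A y] bil_unit_left)

lemma bil_units: "i < n \<Longrightarrow> j < n \<Longrightarrow> bil n A (unit_fun i) (unit_fun j) = A $$ (i, j)"
  by (simp add: bil_unit_left mulv_unit)

lemma bil_cong:
  "(\<And>i. i < n \<Longrightarrow> x i = x' i) \<Longrightarrow> (\<And>i. i < n \<Longrightarrow> y i = y' i) \<Longrightarrow> bil n A x y = bil n A x' y'"
  by (simp add: bil_def mulv_def)

lemma bil_mat_lincomb:
  assumes "\<And>i j. i < n \<Longrightarrow> j < n \<Longrightarrow> A $$ (i, j) = c * B $$ (i, j) + d * C $$ (i, j)"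
  shows "bil n A x y = c * bil n B x y + d * bil n C x y"
  by (simp add: bil_def mulv_def assms sum.distrib sum_distrib_left algebra_simps)

lemma bil_outer:
  assumes "\<And>i j. i < n \<Longrightarrow> j < n \<Longrightarrow> A $$ (i, j) = u i * u j"
  shows "bil n A x y = (\<Sum>i<n. u i * x i) * (\<Sum>i<n. u i * y i)"
  unfolding sum_product by (simp add: bil_def mulv_def assms sum_distrib_left mult_ac)

lemma bil_square_lincomb:
  assumes "sym_mat n A"
  shows "bil n A (\<lambda>i. c * x i + d * y i) (\<lambda>i. c * x i + d * y i)
    = c\<^sup>2 * bil n A x x + 2 * c * d * bil n A x y + d\<^sup>2 * bil n A y y"
  by (simp add: bil_lincomb_left bil_lincomb_right bil_sym[OF assms, of y x]
      power2_eq_square algebra_simps)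

text \<open>After multiplication by \<open>a\<close> the form is a square plus a multiple of its discriminant.\<close>

lemma quadratic_form_2_nonneg:
  fixes a b c s t :: real
  assumes "0 \<le> a" "0 \<le> c" "b\<^sup>2 \<le> a * c"
  shows "0 \<le> a * s\<^sup>2 + 2 * b * s * t + c * t\<^sup>2"
proof (cases "a = 0")
  case True
  then have "b = 0" using assms by simp
  then show ?thesis using True assms by simp
next
  case False
  have "a * (a * s\<^sup>2 + 2 * b * s * t + c * t\<^sup>2) = (a * s + b * t)\<^sup>2 + t\<^sup>2 * (a * c - b\<^sup>2)"
    by (simp add: power2_eq_square algebra_simps)
  also have "\<dots> \<ge> 0" using assms by simp
  finally show ?thesis using False assms by (simp add: zero_le_mult_iff)
qed

lemma psd_on_Cauchy_Schwarz:
  assumes sym: "sym_mat n A" and psd: "psd_on n I A"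
    and x: "\<forall>i<n. i \<notin> I \<longrightarrow> x i = 0" and y: "\<forall>i<n. i \<notin> I \<longrightarrow> y i = 0"
  shows "(bil n A x y)\<^sup>2 \<le> bil n A x x * bil n A y y"
proof -
  have pos: "0 \<le> c\<^sup>2 * bil n A x x + 2 * c * d * bil n A x y + d\<^sup>2 * bil n A y y" for c d
    using psd x y unfolding psd_on_def bil_square_lincomb[OF sym, symmetric] by simp
  show ?thesis
  proof (cases "bil n A y y = 0")
    case True
    \<comment> \<open>If the mixed term were nonzero, a multiple of \<open>y\<close> chosen to scale it to \<open>- (bil n A x x + 1)\<close>
      would make the form negative.\<close>
    have "0 \<le> bil n A x x - 2 * (bil n A x x + 1)" if nz: "bil n A x y \<noteq> 0"
      using pos[of 1 "- (bil n A x x + 1) / bil n A x y"] True nz by simp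
    moreover have "0 \<le> bil n A x x" using pos[of 1 0] by simp
    ultimately have "bil n A x y = 0" by fastforce
    then show ?thesis using True by simp
  next
    case False
    then have ypos: "0 < bil n A y y" using pos[of 0 1] by simp
    have "0 \<le> bil n A y y * (bil n A x x * bil n A y y - (bil n A x y)\<^sup>2)"
      using pos[of "bil n A y y" "- bil n A x y"]
      by (simp add: power2_eq_square algebra_simps)
    then show ?thesis using ypos by (simp add: zero_le_mult_iff)
  qed
qed

text \<open>An isotropic vector of a semidefinite form lies in its radical: pair it with the coordinate
  vectors in Cauchy--Schwarz. Rows outside \<open>I\<close> are not controlled, and the later arguments
  live on exactly this freedom.\<close>

lemma psd_on_isotropic:
  assumes "sym_mat n A" "psd_on n I A" "\<forall>i<n. i \<notin> I \<longrightarrow> x i = 0"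
    and "bil n A x x = 0" "i \<in> I" "i < n"
  shows "mulv n A x i = 0"
proof -
  have "(bil n A (unit_fun i) x)\<^sup>2 \<le> bil n A (unit_fun i) (unit_fun i) * bil n A x x"
    by (rule psd_on_Cauchy_Schwarz[OF assms(1,2) _ assms(3)]) (use assms in \<open>auto simp: unit_fun_def\<close>)
  then show ?thesis using assms by (simp add: bil_unit_left)
qed

section \<open>Principal submatrices as restrictions of the form\<close>

lemma bij_betw_pick:
  assumes "finite I"
  shows "bij_betw (pick I) {..<card I} I"
proof -
  have inj: "inj_on (pick I) {..<card I}"
    by (rule inj_onI) (metis card_pick_le lessThan_iff)
  have "pick I ` {..<card I} \<subseteq> I" using pick_in_set_le by auto
  then have "pick I ` {..<card I} = I"
    using assms by (metis card_image card_lessThan card_subset_eq inj)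
  with inj show ?thesis by (simp add: bij_betw_def)
qed

text \<open>The inverse of restricting a vector to \<open>I\<close>: the position of \<open>j\<close> in the increasing
  enumeration \<open>pick I\<close> is the number of elements of \<open>I\<close> below it.\<close>

definition zero_extend :: "nat set \<Rightarrow> (nat \<Rightarrow> real) \<Rightarrow> nat \<Rightarrow> real" where
  "zero_extend I w j = (if j \<in> I then w (card {a \<in> I. a < j}) else 0)"

lemma extend_pick: "a < card I \<Longrightarrow> zero_extend I w (pick I a) = w a"
  by (simp add: zero_extend_def pick_in_set_le card_pick_le)

lemma extend_restrict:
  assumes "\<forall>i<n. i \<notin> I \<longrightarrow> x i = 0" "i < n"
  shows "zero_extend I (\<lambda>a. x (pick I a)) i = x i"
  using assms by (simp add: zero_extend_def pick_card_in_set)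

lemma sum_extend:
  assumes I: "I \<subseteq> {..<n}"
  shows "(\<Sum>j<n. f j * zero_extend I w j) = (\<Sum>b<card I. f (pick I b) * w b)"
proof -
  have fin: "finite I" using I finite_subset by blast
  have "(\<Sum>j<n. f j * zero_extend I w j) = (\<Sum>j\<in>I. f j * zero_extend I w j)"
    by (rule sum.mono_neutral_right) (use I in \<open>auto simp: zero_extend_def\<close>)
  also have "\<dots> = (\<Sum>b<card I. f (pick I b) * zero_extend I w (pick I b))"
    by (rule sum.reindex_bij_betw[symmetric, OF bij_betw_pick[OF fin]])
  finally show ?thesis by (simp add: extend_pick)
qed

lemma principal_submatrix_carrier:
  assumes "A \<in> carrier_mat n n" "I \<subseteq> {..<n}"
  shows "submatrix A I I \<in> carrier_mat (card I) (card I)"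
proof -
  have "{i. i < n \<and> i \<in> I} = I" using assms by auto
  then show ?thesis using assms by (auto simp: dim_submatrix intro!: carrier_matI)
qed

lemma principal_submatrix_index:
  assumes "A \<in> carrier_mat n n" "I \<subseteq> {..<n}" "a < card I" "b < card I"
  shows "submatrix A I I $$ (a, b) = A $$ (pick I a, pick I b)"
proof -
  have "{i. i < n \<and> i \<in> I} = I" using assms by auto
  then show ?thesis using assms by (simp add: submatrix_index)
qed

lemma mulv_submatrix:
  assumes "A \<in> carrier_mat n n" "I \<subseteq> {..<n}" "a < card I"
  shows "mulv (card I) (submatrix A I I) w a = mulv n A (zero_extend I w) (pick I a)"
  using assms by (simp add: mulv_def sum_extend principal_submatrix_index)

lemma bil_submatrix:
  assumes "A \<in> carrier_mat n n" "I \<subseteq> {..<n}"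
  shows "bil (card I) (submatrix A I I) w w' = bil n A (zero_extend I w) (zero_extend I w')"
proof -
  have "bil n A (zero_extend I w) (zero_extend I w')
    = (\<Sum>j<n. mulv n A (zero_extend I w') j * zero_extend I w j)"
    by (simp add: bil_def mult.commute)
  then show ?thesis
    unfolding sum_extend[OF assms(2)] by (simp add: bil_def mulv_submatrix[OF assms] mult.commute)
qed

lemma mult_mat_vec_eq_mulv:
  assumes "A \<in> carrier_mat n n" "v \<in> carrier_vec n" "i < n"
  shows "(A *\<^sub>v v) $ i = mulv n A (\<lambda>j. v $ j) i"
  using assms by (simp add: mulv_def scalar_prod_def atLeast0LessThan)

lemma psd_mat_iff_psd_on:
  "psd_mat n A \<longleftrightarrow> sym_mat n A \<and> psd_on n UNIV A"
proof -
  have eq: "v \<bullet> (A *\<^sub>v v) = bil n A (\<lambda>j. v $ j) (\<lambda>j. v $ j)"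
    if "A \<in> carrier_mat n n" "v \<in> carrier_vec n" for v
    using that mult_mat_vec_eq_mulv[OF that]
    by (simp add: bil_def scalar_prod_def atLeast0LessThan)
  have eq': "bil n A x x = vec n x \<bullet> (A *\<^sub>v vec n x)" if "A \<in> carrier_mat n n" for x
    unfolding eq[OF that vec_carrier] by (rule bil_cong) auto
  show ?thesis
  proof (cases "sym_mat n A")
    case True
    then have "(\<forall>v\<in>carrier_vec n. 0 \<le> v \<bullet> (A *\<^sub>v v)) \<longleftrightarrow> (\<forall>x. 0 \<le> bil n A x x)"
      using eq[OF sym_mat_carrier] eq'[OF sym_mat_carrier] by (metis vec_carrier)
    then show ?thesis by (simp add: psd_mat_def psd_on_def)
  qed (simp add: psd_mat_def)
qed

lemma sym_mat_submatrix:
  assumes "sym_mat n A" "I \<subseteq> {..<n}"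
  shows "sym_mat (card I) (submatrix A I I)"
proof (rule sym_matI)
  show "submatrix A I I \<in> carrier_mat (card I) (card I)"
    by (rule principal_submatrix_carrier[OF sym_mat_carrier[OF assms(1)] assms(2)])
  fix a b assume ab: "a < card I" "b < card I"
  then have "pick I a < n" "pick I b < n" using assms(2) pick_in_set_le by blast+
  with ab show "submatrix A I I $$ (a, b) = submatrix A I I $$ (b, a)"
    using principal_submatrix_index[OF sym_mat_carrier[OF assms(1)] assms(2)]
      sym_mat_index[OF assms(1)] by simp
qed

lemma psd_mat_submatrix_iff:
  assumes "sym_mat n A" "I \<subseteq> {..<n}"
  shows "psd_mat (card I) (submatrix A I I) \<longleftrightarrow> psd_on n I A"
proof -
  note A = sym_mat_carrier[OF assms(1)]
  have "(\<forall>w. 0 \<le> bil n A (zero_extend I w) (zero_extend I w)) \<longleftrightarrow> psd_on n I A"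
  proof
    assume L: "\<forall>w. 0 \<le> bil n A (zero_extend I w) (zero_extend I w)"
    show "psd_on n I A"
      unfolding psd_on_def
    proof (intro allI impI)
      fix x :: "nat \<Rightarrow> real" assume "\<forall>i<n. i \<notin> I \<longrightarrow> x i = 0"
      then have "bil n A (zero_extend I (\<lambda>a. x (pick I a))) (zero_extend I (\<lambda>a. x (pick I a))) = bil n A x x"
        by (intro bil_cong extend_restrict)
      with L show "0 \<le> bil n A x x" by metis
    qed
  qed (simp add: psd_on_def zero_extend_def)
  then show ?thesis
    using sym_mat_submatrix[OF assms] unfolding psd_mat_iff_psd_on
    by (simp add: psd_on_def[of _ UNIV] bil_submatrix[OF A assms(2)])
qed

section \<open>The closure in terms of forms and of minors\<close>

lemma k_psd_closure_iff:
  "A \<in> k_psd_closure n k \<longleftrightarrow>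
    sym_mat n A \<and> (\<forall>I \<subseteq> {..<n}. card I = k \<longrightarrow> psd_on n I A)"
  unfolding k_psd_closure_def principal_submatrices_def
  using psd_mat_submatrix_iff[of n A] by (auto 0 3)

lemma card_pred_subset_iff:
  assumes "0 < n"
  shows "I \<subseteq> {..<n} \<and> card I = n - 1 \<longleftrightarrow> (\<exists>i<n. I = {..<n} - {i})"
proof
  assume I: "I \<subseteq> {..<n} \<and> card I = n - 1"
  then have "card ({..<n} - I) = 1"
    using assms by (subst card_Diff_subset) (auto intro: finite_subset)
  then obtain i where "{..<n} - I = {i}" by (meson card_1_singletonE)
  with I show "\<exists>i<n. I = {..<n} - {i}" by blast
qed auto

lemma k_psd_closure_pred_iff:
  assumes "0 < n"
  shows "A \<in> k_psd_closure n (n - 1) \<longleftrightarrow>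
    sym_mat n A \<and> (\<forall>i<n. psd_on n (- {i}) A)"
proof -
  have "psd_on n ({..<n} - {i}) A \<longleftrightarrow> psd_on n (- {i}) A" for i
    by (simp add: psd_on_def)
  then have "(\<forall>I. I \<subseteq> {..<n} \<and> card I = n - 1 \<longrightarrow> psd_on n I A) \<longleftrightarrow> (\<forall>i<n. psd_on n (- {i}) A)"
    unfolding card_pred_subset_iff[OF assms] by auto
  then show ?thesis unfolding k_psd_closure_iff imp_conjL by (simp only:)
qed

text \<open>Since \<open>k \<ge> 2\<close>, any two indices lie in a common index set of size \<open>k\<close>, so the closure of
  order \<open>k\<close> is contained in the one of order two.\<close>

lemma k_psd_closure_minors:
  assumes A: "A \<in> k_psd_closure n k" and k: "2 \<le> k" "k \<le> n" and ij: "i < n" "j < n"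
  shows "0 \<le> A $$ (i, i)" "(A $$ (i, j))\<^sup>2 \<le> A $$ (i, i) * A $$ (j, j)"
proof -
  have "card {i, j} \<le> k" using k(1) by (simp add: card_insert_if)
  then obtain I where I: "{i, j} \<subseteq> I" "I \<subseteq> {..<n}" "card I = k"
    using exists_subset_between[of "{i, j}" k "{..<n}"] ij k(2) by auto
  have sym: "sym_mat n A" and psd: "psd_on n I A" using A I by (auto simp: k_psd_closure_iff)
  have supp: "\<forall>l<n. l \<notin> I \<longrightarrow> unit_fun i l = 0" "\<forall>l<n. l \<notin> I \<longrightarrow> unit_fun j l = 0"
    using I by (auto simp: unit_fun_def)
  have "0 \<le> bil n A (unit_fun i) (unit_fun i)" using psd supp unfolding psd_on_def by blast
  then show "0 \<le> A $$ (i, i)" using ij by (simp add: bil_units)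
  show "(A $$ (i, j))\<^sup>2 \<le> A $$ (i, i) * A $$ (j, j)"
    using psd_on_Cauchy_Schwarz[OF sym psd supp] ij by (simp add: bil_units)
qed

lemma k_psd_closure_2I:
  assumes sym: "sym_mat n A" and diag: "\<And>i. i < n \<Longrightarrow> 0 \<le> A $$ (i, i)"
    and minor: "\<And>i j. i < n \<Longrightarrow> j < n \<Longrightarrow> i \<noteq> j \<Longrightarrow> (A $$ (i, j))\<^sup>2 \<le> A $$ (i, i) * A $$ (j, j)"
  shows "A \<in> k_psd_closure n 2"
  unfolding k_psd_closure_iff
proof (intro conjI allI impI sym)
  fix I assume I: "I \<subseteq> {..<n}" "card I = 2"
  then obtain i j where ij: "I = {i, j}" "i \<noteq> j" by (auto simp: card_2_iff)
  with I have lt: "i < n" "j < n" by auto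
  show "psd_on n I A"
    unfolding psd_on_def
  proof (intro allI impI)
    fix x :: "nat \<Rightarrow> real" assume x: "\<forall>l<n. l \<notin> I \<longrightarrow> x l = 0"
    let ?a = "A $$ (i, i)" and ?b = "A $$ (i, j)" and ?c = "A $$ (j, j)"
    have "bil n A x x = bil n A (\<lambda>l. x i * unit_fun i l + x j * unit_fun j l) (\<lambda>l. x i * unit_fun i l + x j * unit_fun j l)"
      by (rule bil_cong) (use x ij in \<open>auto simp: unit_fun_def\<close>)
    also have "\<dots> = (x i)\<^sup>2 * ?a + 2 * x i * x j * ?b + (x j)\<^sup>2 * ?c"
      using lt by (simp add: bil_square_lincomb[OF sym] bil_units)
    also have "\<dots> = ?a * (x i)\<^sup>2 + 2 * ?b * x i * x j + ?c * (x j)\<^sup>2"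
      by (simp add: mult_ac)
    also have "\<dots> \<ge> 0"
      by (rule quadratic_form_2_nonneg[OF diag[OF lt(1)] diag[OF lt(2)] minor[OF lt ij(2)]])
    finally show "0 \<le> bil n A x x" .
  qed
qed

section \<open>Matrices with vanishing principal minors of order two\<close>

text \<open>A singular positive semidefinite matrix of order two has the kernel vector with entries
  \<open>x12\<close> and \<open>- x11\<close>. The form of the sum vanishes there, hence so does that of each
  semidefinite summand, and the kernel vector is annihilated by both rows of \<open>y\<close>. The two
  conclusions say precisely that.\<close>

lemma rank_one_2x2_summand:
  fixes y11 y12 y22 z11 z12 z22 :: real
  assumes y: "0 \<le> y11" "0 \<le> y22" "y12\<^sup>2 \<le> y11 * y22"
    and z: "0 \<le> z11" "0 \<le> z22" "z12\<^sup>2 \<le> z11 * z22"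
    and x: "(y12 + z12)\<^sup>2 = (y11 + z11) * (y22 + z22)"
  shows "y11 * (y12 + z12) = y12 * (y11 + z11)"
    and "y12 * (y12 + z12) = y22 * (y11 + z11)"
proof -
  define s t where "s = y12 + z12" and "t = - (y11 + z11)"
  define Q where "Q = y11 * s\<^sup>2 + 2 * y12 * s * t + y22 * t\<^sup>2"
  define R where "R = z11 * s\<^sup>2 + 2 * z12 * s * t + z22 * t\<^sup>2"
  have "Q + R = - t * s\<^sup>2 + 2 * s * s * t + (y22 + z22) * t\<^sup>2"
    unfolding Q_def R_def s_def t_def by (simp add: power2_eq_square algebra_simps)
  also have "\<dots> = t * (s\<^sup>2 - (y11 + z11) * (y22 + z22))"
    unfolding t_def by (simp add: power2_eq_square algebra_simps)
  finally have "Q + R = 0" using x by (simp add: s_def)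
  moreover have "0 \<le> Q" "0 \<le> R"
    unfolding Q_def R_def using y z by (auto intro: quadratic_form_2_nonneg)
  ultimately have Q0: "Q = 0" by simp
  have "(y11 * s + y12 * t)\<^sup>2 + t\<^sup>2 * (y11 * y22 - y12\<^sup>2) = y11 * Q"
    unfolding Q_def by (simp add: power2_eq_square algebra_simps)
  moreover have "0 \<le> t\<^sup>2 * (y11 * y22 - y12\<^sup>2)" using y by simp
  ultimately have "(y11 * s + y12 * t)\<^sup>2 \<le> 0" unfolding Q0 mult_zero_right by linarith
  then show "y11 * (y12 + z12) = y12 * (y11 + z11)" by (simp add: s_def t_def algebra_simps)
  have "(y12 * s + y22 * t)\<^sup>2 + s\<^sup>2 * (y11 * y22 - y12\<^sup>2) = y22 * Q"
    unfolding Q_def by (simp add: power2_eq_square algebra_simps)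
  moreover have "0 \<le> s\<^sup>2 * (y11 * y22 - y12\<^sup>2)" using y by simp
  ultimately have "(y12 * s + y22 * t)\<^sup>2 \<le> 0" unfolding Q0 mult_zero_right by linarith
  then show "y12 * (y12 + z12) = y22 * (y11 + z11)" by (simp add: s_def t_def algebra_simps)
qed

lemma k_psd_closure_carrier: "A \<in> k_psd_closure n k \<Longrightarrow> A \<in> carrier_mat n n"
  by (simp add: k_psd_closure_iff sym_mat_def)

lemma spans_extreme_rayI:
  assumes "X \<in> k_psd_closure n k" "X \<noteq> 0\<^sub>m n n"
    and "\<And>Y Z. Y \<in> k_psd_closure n k \<Longrightarrow> Z \<in> k_psd_closure n k \<Longrightarrow> X = Y + Z \<Longrightarrow>
      \<exists>a\<ge>0. Y = a \<cdot>\<^sub>m X"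
  shows "spans_extreme_ray n (k_psd_closure n k) X"
  unfolding spans_extreme_ray_def
proof (intro conjI ballI impI assms(1,2))
  fix Y Z assume YZ: "Y \<in> k_psd_closure n k" "Z \<in> k_psd_closure n k" "X = Y + Z"
  then show "\<exists>a\<ge>0. Y = a \<cdot>\<^sub>m X" by (rule assms(3))
  have "X = Z + Y" using YZ comm_add_mat k_psd_closure_carrier by metis
  with YZ show "\<exists>b\<ge>0. Z = b \<cdot>\<^sub>m X" by (intro assms(3)[of Z Y])
qed

lemma k_psd_closure_pos_diag:
  assumes X: "X \<in> k_psd_closure n k" "X \<noteq> 0\<^sub>m n n" and k: "2 \<le> k" "k \<le> n"
  obtains p where "p < n" "0 < X $$ (p, p)"
proof -
  have "X = 0\<^sub>m n n" if "\<And>i j. i < n \<Longrightarrow> j < n \<Longrightarrow> X $$ (i, j) = 0"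
    using k_psd_closure_carrier[OF X(1)] that by (intro eq_matI) auto
  with X(2) obtain i j where ij: "i < n" "j < n" "X $$ (i, j) \<noteq> 0" by blast
  have "0 \<le> X $$ (i, i)" "(X $$ (i, j))\<^sup>2 \<le> X $$ (i, i) * X $$ (j, j)"
    using k_psd_closure_minors[OF X(1) k ij(1,2)] by auto
  moreover have "0 < (X $$ (i, j))\<^sup>2" using ij by simp
  ultimately have "0 < X $$ (i, i)" by (cases "X $$ (i, i) = 0") auto
  with ij that show ?thesis by blast
qed

text \<open>Only minors of order two are used. By \<open>rank_one_2x2_summand\<close>, a summand \<open>Y\<close> is proportional to
  \<open>X\<close> on every pair of indices; an index with positive diagonal entry links all the factors.
  Entries in a zero row of \<open>X\<close> vanish in \<open>Y\<close> because its diagonal entry does.\<close>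

lemma rank_one_minors_imp_extreme:
  assumes k: "2 \<le> k" "k \<le> n" and X: "X \<in> k_psd_closure n k" "X \<noteq> 0\<^sub>m n n"
    and minors: "\<And>i j. i < n \<Longrightarrow> j < n \<Longrightarrow> (X $$ (i, j))\<^sup>2 = X $$ (i, i) * X $$ (j, j)"
  shows "spans_extreme_ray n (k_psd_closure n k) X"
proof (rule spans_extreme_rayI[OF X])
  fix Y Z assume Y: "Y \<in> k_psd_closure n k" and Z: "Z \<in> k_psd_closure n k" and XYZ: "X = Y + Z"
  note Yc = k_psd_closure_carrier[OF Y] and Zc = k_psd_closure_carrier[OF Z]
  note Xc = k_psd_closure_carrier[OF X(1)]
  have ent: "X $$ (i, j) = Y $$ (i, j) + Z $$ (i, j)" if "i < n" "j < n" for i j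
    using that Yc Zc XYZ by simp
  have par: "Y $$ (i, i) * X $$ (i, j) = Y $$ (i, j) * X $$ (i, i)"
      "Y $$ (i, j) * X $$ (i, j) = Y $$ (j, j) * X $$ (i, i)" if ij: "i < n" "j < n" for i j
    using rank_one_2x2_summand[OF
        k_psd_closure_minors(1)[OF Y k ij(1,1)] k_psd_closure_minors(1)[OF Y k ij(2,2)]
        k_psd_closure_minors(2)[OF Y k ij]
        k_psd_closure_minors(1)[OF Z k ij(1,1)] k_psd_closure_minors(1)[OF Z k ij(2,2)]
        k_psd_closure_minors(2)[OF Z k ij]] minors[OF ij] ij ent by simp_all
  obtain p where p: "p < n" "0 < X $$ (p, p)" using k_psd_closure_pos_diag[OF X k] by blast
  define a where "a = Y $$ (p, p) / X $$ (p, p)"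
  have diag: "Y $$ (i, i) = a * X $$ (i, i)" if i: "i < n" for i
  proof -
    have "Y $$ (i, i) * (X $$ (p, p))\<^sup>2 = (Y $$ (p, i) * X $$ (p, p)) * X $$ (p, i)"
      using par(2)[OF p(1) i] by (simp add: power2_eq_square)
    also have "\<dots> = Y $$ (p, p) * (X $$ (p, i))\<^sup>2"
      using par(1)[OF p(1) i] by (simp add: power2_eq_square)
    also have "\<dots> = Y $$ (p, p) * (X $$ (p, p) * X $$ (i, i))"
      using minors[OF p(1) i] by simp
    finally show ?thesis using p by (simp add: a_def power2_eq_square field_simps)
  qed
  have "Y $$ (i, j) = a * X $$ (i, j)" if ij: "i < n" "j < n" for i j
  proof (cases "X $$ (i, i) = 0")
    case True
    then show ?thesis
      using k_psd_closure_minors(2)[OF Y k ij] minors[OF ij] diag[OF ij(1)] by simp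
  next
    case False
    then show ?thesis using par(1)[OF ij] diag[OF ij(1)] by simp
  qed
  then have "Y = a \<cdot>\<^sub>m X" using Xc Yc by (auto intro!: eq_matI)
  moreover have "0 \<le> a"
    using k_psd_closure_minors(1)[OF Y k p(1,1)] p(2) by (simp add: a_def)
  ultimately show "\<exists>a\<ge>0. Y = a \<cdot>\<^sub>m X" by blast
qed

text \<open>If the minor on \<open>i\<close> and \<open>j\<close> is strictly positive, the entry at \<open>(i, j)\<close> can be moved both
  ways without leaving the closure of order two. The two perturbations of half the matrix are a
  decomposition that keeps the diagonal but not this entry, so it is not proportional.\<close>

lemma extreme_2_imp_minors:
  assumes n: "2 \<le> n" and ext: "spans_extreme_ray n (k_psd_closure n 2) X"
    and ij: "i < n" "j < n"
  shows "(X $$ (i, j))\<^sup>2 = X $$ (i, i) * X $$ (j, j)"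
proof (rule ccontr)
  have X: "X \<in> k_psd_closure n 2" using ext by (simp add: spans_extreme_ray_def)
  note Xc = k_psd_closure_carrier[OF X]
  have sym: "sym_mat n X" using X by (simp add: k_psd_closure_iff)
  note minors = k_psd_closure_minors[OF X order_refl n]
  assume "(X $$ (i, j))\<^sup>2 \<noteq> X $$ (i, i) * X $$ (j, j)"
  then have strict: "(X $$ (i, j))\<^sup>2 < X $$ (i, i) * X $$ (j, j)" and ne: "i \<noteq> j"
    using minors(2)[OF ij] by (auto simp: power2_eq_square)
  define s where "s = sqrt (X $$ (i, i) * X $$ (j, j))"
  have s2: "s\<^sup>2 = X $$ (i, i) * X $$ (j, j)" using minors(1) ij by (simp add: s_def)
  have s: "\<bar>X $$ (i, j)\<bar> < s" using strict unfolding s_def by (simp add: real_less_rsqrt)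
  \<comment> \<open>The largest shift of half the entry that keeps its modulus at most \<open>s / 2\<close>.\<close>
  define e where "e = (s - \<bar>X $$ (i, j)\<bar>) / 2"
  define W where "W c = mat n n (\<lambda>(p, q). X $$ (p, q) / 2 + (if {p, q} = {i, j} then c else 0))" for c
  have W: "W c \<in> k_psd_closure n 2" if c: "\<bar>c\<bar> \<le> e" for c
  proof (rule k_psd_closure_2I)
    show "sym_mat n (W c)"
      using sym_mat_index[OF sym] by (intro sym_matI) (auto simp: W_def insert_commute)
    show "0 \<le> W c $$ (p, p)" if "p < n" for p
      using minors(1)[OF that that] ne that by (auto simp: W_def)
    fix p q assume pq: "p < n" "q < n" "p \<noteq> q"
    show "(W c $$ (p, q))\<^sup>2 \<le> W c $$ (p, p) * W c $$ (q, q)"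
    proof (cases "{p, q} = {i, j}")
      case True
      then have Xpq: "X $$ (p, q) = X $$ (i, j)" "X $$ (p, p) * X $$ (q, q) = s\<^sup>2"
        using sym_mat_index[OF sym ij] by (auto simp: doubleton_eq_iff s2 mult.commute)
      have "\<bar>X $$ (i, j) / 2 + c\<bar> \<le> s / 2" using c unfolding e_def by (auto simp: abs_if field_simps split: if_splits)
      then have "(X $$ (i, j) / 2 + c)\<^sup>2 \<le> (s / 2)\<^sup>2" by (rule power2_le_iff_abs_le[THEN iffD2, rotated]) (use s in auto)
      moreover have "W c $$ (p, q) = X $$ (i, j) / 2 + c" using pq True Xpq by (simp add: W_def)
      moreover have "W c $$ (p, p) * W c $$ (q, q) = (s / 2)\<^sup>2"
      proof -
        have half: "W c $$ (p, p) = X $$ (p, p) / 2" "W c $$ (q, q) = X $$ (q, q) / 2"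
          using pq ne by (auto simp: W_def)
        show ?thesis unfolding half using Xpq(2) by (simp add: power_divide)
      qed
      ultimately show ?thesis by simp
    next
      case False
      then have half: "W c $$ (p, q) = X $$ (p, q) / 2" "W c $$ (p, p) = X $$ (p, p) / 2"
        "W c $$ (q, q) = X $$ (q, q) / 2"
        using pq ne by (auto simp: W_def)
      show ?thesis unfolding half using minors(2)[OF pq(1,2)] by (simp add: power_divide)
    qed
  qed
  have e: "0 < e" using s by (simp add: e_def)
  have "X = W e + W (- e)" using Xc by (auto simp: W_def intro!: eq_matI)
  then obtain a where a: "W e = a \<cdot>\<^sub>m X"
    using ext W[of e] W[of "- e"] e unfolding spans_extreme_ray_def by auto
  have "W e $$ (i, i) = X $$ (i, i) / 2" "W e $$ (i, j) = X $$ (i, j) / 2 + e"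
    using ij ne by (auto simp: W_def)
  moreover have "W e $$ (i, i) = a * X $$ (i, i)" "W e $$ (i, j) = a * X $$ (i, j)"
    using a Xc ij by auto
  moreover have "X $$ (i, i) \<noteq> 0" using s2 s by auto
  ultimately have a: "a = 1 / 2" and "a * X $$ (i, j) = X $$ (i, j) / 2 + e" by auto
  from this(2) show False using e unfolding a by simp
qed

section \<open>Determinants, kernels and ranks of principal submatrices\<close>

lemma det_zero_iff_mulv:
  assumes A: "A \<in> carrier_mat n n"
  shows "det A = 0 \<longleftrightarrow> (\<exists>w. (\<exists>i<n. w i \<noteq> 0) \<and> (\<forall>i<n. mulv n A w i = 0))"
proof
  assume "det A = 0"
  then obtain v where v: "v \<in> carrier_vec n" "v \<noteq> 0\<^sub>v n" "A *\<^sub>v v = 0\<^sub>v n"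
    using det_0_iff_vec_prod_zero[OF A] by blast
  have "\<exists>i<n. v $ i \<noteq> 0" using v(1,2) by (auto intro!: eq_vecI)
  moreover have "\<forall>i<n. mulv n A (\<lambda>j. v $ j) i = 0"
    using mult_mat_vec_eq_mulv[OF A v(1)] v(3) by simp
  ultimately show "\<exists>w. (\<exists>i<n. w i \<noteq> 0) \<and> (\<forall>i<n. mulv n A w i = 0)" by blast
next
  assume "\<exists>w. (\<exists>i<n. w i \<noteq> 0) \<and> (\<forall>i<n. mulv n A w i = 0)"
  then obtain w i where w: "i < n" "w i \<noteq> 0" "\<And>i. i < n \<Longrightarrow> mulv n A w i = 0" by blast
  have "vec n w \<noteq> 0\<^sub>v n" using w(1,2) by (metis index_vec index_zero_vec(1))
  moreover have "A *\<^sub>v vec n w = 0\<^sub>v n"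
  proof (rule eq_vecI)
    fix i assume "i < dim_vec (0\<^sub>v n :: real vec)"
    then have i: "i < n" by simp
    have "(A *\<^sub>v vec n w) $ i = mulv n A w i"
      unfolding mult_mat_vec_eq_mulv[OF A vec_carrier i] by (simp add: mulv_def)
    then show "(A *\<^sub>v vec n w) $ i = 0\<^sub>v n $ i" using w(3) i by simp
  qed (use A in auto)
  ultimately show "det A = 0" using det_0_iff_vec_prod_zero[OF A] vec_carrier by blast
qed

text \<open>Kernel vectors of a principal submatrix, seen as vectors of the ambient space: the image may
  be nonzero, but only outside \<open>I\<close>.\<close>

lemma det_submatrix_zero_iff:
  assumes A: "A \<in> carrier_mat n n" and I: "I \<subseteq> {..<n}"
  shows "det (submatrix A I I) = 0 \<longleftrightarrow>
    (\<exists>x. (\<forall>i. i \<notin> I \<longrightarrow> x i = 0) \<and> (\<exists>i\<in>I. x i \<noteq> 0) \<and> (\<forall>i\<in>I. mulv n A x i = 0))"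
proof -
  have fin: "finite I" using I finite_subset by blast
  have pick: "pick I ` {..<card I} = I" using bij_betw_pick[OF fin] by (simp add: bij_betw_def)
  have "(\<forall>i\<in>pick I ` {..<card I}. P i) \<longleftrightarrow> (\<forall>a<card I. P (pick I a))" for P
    by auto
  then have ball: "(\<forall>i\<in>I. P i) \<longleftrightarrow> (\<forall>a<card I. P (pick I a))" for P
    unfolding pick .
  have bex: "(\<exists>i\<in>I. P i) \<longleftrightarrow> (\<exists>a<card I. P (pick I a))" for P
    using ball[of "\<lambda>i. \<not> P i"] by blast
  have "det (submatrix A I I) = 0 \<longleftrightarrow> (\<exists>w. (\<exists>i\<in>I. zero_extend I w i \<noteq> 0) \<and>
      (\<forall>i\<in>I. mulv n A (zero_extend I w) i = 0))"
    unfolding det_zero_iff_mulv[OF principal_submatrix_carrier[OF A I]] ball bex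
    by (simp add: extend_pick mulv_submatrix[OF A I] cong: conj_cong)
  also have "\<dots> \<longleftrightarrow> (\<exists>x. (\<forall>i. i \<notin> I \<longrightarrow> x i = 0) \<and> (\<exists>i\<in>I. x i \<noteq> 0) \<and> (\<forall>i\<in>I. mulv n A x i = 0))"
  proof
    assume "\<exists>x. (\<forall>i. i \<notin> I \<longrightarrow> x i = 0) \<and> (\<exists>i\<in>I. x i \<noteq> 0) \<and> (\<forall>i\<in>I. mulv n A x i = 0)"
    then obtain x where x: "\<forall>i. i \<notin> I \<longrightarrow> x i = 0" "\<exists>i\<in>I. x i \<noteq> 0" "\<forall>i\<in>I. mulv n A x i = 0"
      by blast
    have "zero_extend I (\<lambda>a. x (pick I a)) = x"
    proof
      fix i show "zero_extend I (\<lambda>a. x (pick I a)) i = x i"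
        using x(1) by (simp add: zero_extend_def pick_card_in_set)
    qed
    with x(2,3) show "\<exists>w. (\<exists>i\<in>I. zero_extend I w i \<noteq> 0) \<and> (\<forall>i\<in>I. mulv n A (zero_extend I w) i = 0)"
      by (intro exI[of _ "\<lambda>a. x (pick I a)"]) simp
  next
    assume "\<exists>w. (\<exists>i\<in>I. zero_extend I w i \<noteq> 0) \<and> (\<forall>i\<in>I. mulv n A (zero_extend I w) i = 0)"
    then obtain w where w: "\<exists>i\<in>I. zero_extend I w i \<noteq> 0" "\<forall>i\<in>I. mulv n A (zero_extend I w) i = 0"
      by blast
    have "\<forall>i. i \<notin> I \<longrightarrow> zero_extend I w i = 0" by (simp add: zero_extend_def)
    with w show "\<exists>x. (\<forall>i. i \<notin> I \<longrightarrow> x i = 0) \<and> (\<exists>i\<in>I. x i \<noteq> 0) \<and> (\<forall>i\<in>I. mulv n A x i = 0)"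
      by (intro exI[of _ "zero_extend I w"]) simp
  qed
  finally show ?thesis .
qed

text \<open>A minor of order two on distinct indices would otherwise force rank two. Its kernel vector
  solves the two-by-two system, whose determinant is therefore zero.\<close>

lemma rank_le_1_imp_2x2_minor_zero:
  fixes B :: "real mat"
  assumes B: "B \<in> carrier_mat k k" and rank: "vec_space.rank k B \<le> 1"
    and ab: "a < k" "b < k"
  shows "B $$ (a, b) * B $$ (b, a) = B $$ (a, a) * B $$ (b, b)"
proof (cases "a = b")
  case False
  have ab_sub: "{a, b} \<subseteq> {..<k}" using ab by simp
  have "det (submatrix B {a, b} {a, b}) = 0"
  proof (rule ccontr)
    assume "det (submatrix B {a, b} {a, b}) \<noteq> 0"
    from vec_space.rank_gt_minor[OF B this]
    have "card {j. j < k \<and> j \<in> {a, b}} \<le> 1" using rank by linarith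
    moreover have "{j. j < k \<and> j \<in> {a, b}} = {a, b}" using ab by auto
    ultimately show False using False by simp
  qed
  then obtain x where x: "\<forall>i. i \<notin> {a, b} \<longrightarrow> x i = 0" "\<exists>i\<in>{a, b}. x i \<noteq> 0"
      "\<forall>i\<in>{a, b}. mulv k B x i = 0"
    unfolding det_submatrix_zero_iff[OF B ab_sub] by blast
  have "mulv k B x i = B $$ (i, a) * x a + B $$ (i, b) * x b" for i
  proof -
    have "mulv k B x i = (\<Sum>j\<in>{a, b}. B $$ (i, j) * x j)"
      unfolding mulv_def by (rule sum.mono_neutral_right) (use ab x in auto)
    then show ?thesis using False by simp
  qed
  with x(3) have eqs: "B $$ (a, a) * x a + B $$ (a, b) * x b = 0"
    "B $$ (b, a) * x a + B $$ (b, b) * x b = 0" by auto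
  let ?d = "B $$ (a, a) * B $$ (b, b) - B $$ (a, b) * B $$ (b, a)"
  have "?d * x a = B $$ (b, b) * (B $$ (a, a) * x a + B $$ (a, b) * x b)
      - B $$ (a, b) * (B $$ (b, a) * x a + B $$ (b, b) * x b)"
    by (simp add: algebra_simps)
  then have da: "?d * x a = 0" unfolding eqs by simp
  have "?d * x b = B $$ (a, a) * (B $$ (b, a) * x a + B $$ (b, b) * x b)
      - B $$ (b, a) * (B $$ (a, a) * x a + B $$ (a, b) * x b)"
    by (simp add: algebra_simps)
  then have db: "?d * x b = 0" unfolding eqs by simp
  from x(2) have "x a \<noteq> 0 \<or> x b \<noteq> 0" by simp
  with da db have "?d = 0" by (metis mult_eq_0_iff)
  then show ?thesis by simp
qed simp

lemma principal_rank_le_1_imp_minors: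
  assumes sym: "sym_mat n X" and k: "2 \<le> k" "k \<le> n"
    and rank: "\<forall>B \<in> principal_submatrices n k X. vec_space.rank k B \<le> 1"
    and ij: "i < n" "j < n"
  shows "(X $$ (i, j))\<^sup>2 = X $$ (i, i) * X $$ (j, j)"
proof -
  note Xc = sym_mat_carrier[OF sym]
  have "card {i, j} \<le> k" using k(1) by (simp add: card_insert_if)
  then obtain I where I: "{i, j} \<subseteq> I" "I \<subseteq> {..<n}" "card I = k"
    using exists_subset_between[of "{i, j}" k "{..<n}"] ij k(2) by auto
  have fin: "finite I" using I finite_subset by blast
  have "pick I ` {..<k} = I" using bij_betw_pick[OF fin] I(3) by (simp add: bij_betw_def)
  then have "i \<in> pick I ` {..<k}" "j \<in> pick I ` {..<k}" using I(1) by auto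
  then obtain a b where ab: "a < k" "b < k" "pick I a = i" "pick I b = j" by blast
  have "submatrix X I I \<in> principal_submatrices n k X"
    using I by (auto simp: principal_submatrices_def)
  with rank have "vec_space.rank k (submatrix X I I) \<le> 1" by blast
  from rank_le_1_imp_2x2_minor_zero[OF principal_submatrix_carrier[OF Xc I(2), unfolded I(3)] this ab(1,2)]
  show ?thesis
    using ab I principal_submatrix_index[OF Xc I(2)] sym_mat_index[OF sym ij]
    by (simp add: power2_eq_square)
qed

text \<open>For order two the vanishing determinant suffices. For larger orders it would not, since the
  equations between squares leave the signs of the entries open; compare
  \<open>product_entries_imp_principal_rank_le_1\<close>.\<close>

lemma minors_imp_rank_le_1_2x2:
  assumes sym: "sym_mat n X" 
    and minors: "\<And>i j. i < n \<Longrightarrow> j < n \<Longrightarrow> (X $$ (i, j))\<^sup>2 = X $$ (i, i) * X $$ (j, j)"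
    and B: "B \<in> principal_submatrices n 2 X"
  shows "vec_space.rank 2 B \<le> 1"
proof -
  note Xc = sym_mat_carrier[OF sym]
  obtain I where I: "B = submatrix X I I" "I \<subseteq> {..<n}" "card I = 2"
    using B unfolding principal_submatrices_def by blast
  from I(3) obtain i j where ij: "I = {i, j}" "i \<noteq> j" by (auto simp: card_2_iff)
  have lt: "i < n" "j < n" using ij(1) I(2) by auto
  have mulv: "mulv n X x l = X $$ (l, i) * x i + X $$ (l, j) * x j"
    if "\<And>p. p \<notin> I \<Longrightarrow> x p = 0" for x l
  proof -
    have "mulv n X x l = (\<Sum>p\<in>I. X $$ (l, p) * x p)"
      unfolding mulv_def by (rule sum.mono_neutral_right) (use I that in auto)
    then show ?thesis using ij by simp
  qed
  have minor: "X $$ (i, j) * X $$ (j, i) = X $$ (i, i) * X $$ (j, j)"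
    using minors[OF lt] sym_mat_index[OF sym lt] by (simp add: power2_eq_square)
  have "det B = 0"
    unfolding I(1) det_submatrix_zero_iff[OF Xc I(2)]
  proof (cases "X $$ (i, i) = 0 \<and> X $$ (i, j) = 0")
    case True
    let ?y = "unit_fun i"
    show "\<exists>x. (\<forall>l. l \<notin> I \<longrightarrow> x l = 0) \<and> (\<exists>l\<in>I. x l \<noteq> 0) \<and> (\<forall>l\<in>I. mulv n X x l = 0)"
      using True ij mulv[of ?y] sym_mat_index[OF sym lt]
      by (intro exI[of _ ?y]) (auto simp: unit_fun_def)
  next
    case False
    let ?x = "\<lambda>l. if l = i then - X $$ (i, j) else if l = j then X $$ (i, i) else 0"
    show "\<exists>x. (\<forall>l. l \<notin> I \<longrightarrow> x l = 0) \<and> (\<exists>l\<in>I. x l \<noteq> 0) \<and> (\<forall>l\<in>I. mulv n X x l = 0)"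
      using False ij mulv[of ?x] minor by (intro exI[of _ ?x]) (auto simp: mult.commute)
  qed
  then show ?thesis
    using vec_space.det_zero_low_rank[of B 2] principal_submatrix_carrier[OF Xc I(2)] I by simp
qed

section \<open>Determinants and definiteness\<close>

text \<open>On the segment from the identity to \<open>A\<close> all matrices before \<open>A\<close> are positive definite,
  hence nonsingular. A continuous function that is one at the start and has no zero before the
  end cannot be negative at the end.\<close>

lemma det_nonneg_if_psd:
  assumes A: "A \<in> carrier_mat n n" and psd: "psd_on n UNIV A"
  shows "0 \<le> det A"
proof (rule ccontr)
  assume neg: "\<not> 0 \<le> det A"
  define M where "M r = mat n n (\<lambda>(i, j). (1 - r) * (1\<^sub>m n $$ (i, j)) + r * A $$ (i, j))" for r :: real
  have M: "M r \<in> carrier_mat n n" for r by (simp add: M_def)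
  have M0: "M 0 = 1\<^sub>m n" by (auto simp: M_def intro!: eq_matI)
  have M1: "M 1 = A" using A by (auto simp: M_def intro!: eq_matI)
  have det_M: "det (M r) = (\<Sum>p | p permutes {0..<n}. signof p *
      (\<Prod>i = 0..<n. (1 - r) * (1\<^sub>m n $$ (i, p i)) + r * A $$ (i, p i)))" for r
    unfolding det_def'[OF M]
  proof (rule sum.cong[OF refl])
    fix p assume "p \<in> {p. p permutes {0..<n}}"
    then have p: "p i < n" if "i < n" for i using permutes_in_image[of p "{0..<n}" i] that by simp
    have "(\<Prod>i = 0..<n. M r $$ (i, p i)) =
        (\<Prod>i = 0..<n. (1 - r) * (1\<^sub>m n $$ (i, p i)) + r * A $$ (i, p i))"
      by (rule prod.cong) (simp_all add: M_def p)
    then show "signof p * (\<Prod>i = 0..<n. M r $$ (i, p i)) =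
        signof p * (\<Prod>i = 0..<n. (1 - r) * (1\<^sub>m n $$ (i, p i)) + r * A $$ (i, p i))"
      by (rule arg_cong)
  qed
  have "continuous_on {0..1} (\<lambda>r. det (M r))"
    unfolding det_M by (intro continuous_intros)
  then obtain r where r: "0 \<le> r" "r \<le> 1" "det (M r) = 0"
    using IVT2'[of "\<lambda>r. det (M r)" 1 0 0] M0 M1 neg by auto
  have "r \<noteq> 1" using r(3) M1 neg by auto
  then obtain w i where w: "i < n" "w i \<noteq> 0" "\<forall>i<n. mulv n (M r) w i = 0"
    using r(3) unfolding det_zero_iff_mulv[OF M] by blast
  have one: "bil n (1\<^sub>m n) w w = (\<Sum>i<n. (w i)\<^sup>2)"
  proof -
    have "mulv n (1\<^sub>m n) w j = w j" if "j < n" for j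
    proof -
      have "mulv n (1\<^sub>m n) w j = (\<Sum>l<n. if l = j then w l else 0)"
        unfolding mulv_def by (rule sum.cong) (use that in auto)
      then show ?thesis using that by simp
    qed
    then show ?thesis by (simp add: bil_def power2_eq_square)
  qed
  have "(1 - r) * (\<Sum>i<n. (w i)\<^sup>2) + r * bil n A w w = bil n (M r) w w"
    unfolding one[symmetric] by (rule bil_mat_lincomb[symmetric]) (simp add: M_def)
  also have "\<dots> = 0" using w(3) by (simp add: bil_def)
  finally have "(1 - r) * (\<Sum>i<n. (w i)\<^sup>2) + r * bil n A w w = 0" .
  moreover have "0 \<le> r * bil n A w w" using r psd by (simp add: psd_on_def)
  moreover have "0 < (\<Sum>i<n. (w i)\<^sup>2)" by (rule sum_pos2[of _ i]) (use w in auto)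
  then have "0 < (1 - r) * (\<Sum>i<n. (w i)\<^sup>2)" using r \<open>r \<noteq> 1\<close> by simp
  ultimately show False by linarith
qed

text \<open>The matrix determinant lemma: the block matrix \<open>?N\<close> becomes block triangular when
  multiplied by the unipotent \<open>?U\<close> on either side, and the two Schur complements have the same
  determinant.\<close>

lemma det_identity_plus_outer:
  fixes a b :: "nat \<Rightarrow> real"
  shows "det (mat n n (\<lambda>(i, j). (if i = j then 1 else 0) + a i * b j)) = 1 + (\<Sum>i<n. a i * b i)"
proof -
  let ?a = "mat n 1 (\<lambda>(i, j). a i)" and ?b = "mat 1 n (\<lambda>(i, j). b j)"
  let ?M = "mat n n (\<lambda>(i, j). (if i = j then 1 else 0) + a i * b j)"
  let ?s = "mat 1 1 (\<lambda>_. 1 + (\<Sum>i<n. a i * b i))"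
  let ?U = "four_block_mat (1\<^sub>m n) ?a (0\<^sub>m 1 n) (1\<^sub>m 1)"
  let ?N = "four_block_mat (1\<^sub>m n) (- ?a) ?b (1\<^sub>m 1)"
  have U: "?U \<in> carrier_mat (n + 1) (n + 1)" and N: "?N \<in> carrier_mat (n + 1) (n + 1)"
    by (auto intro!: four_block_carrier_mat)
  have "det ?U = det (1\<^sub>m n :: real mat) * det (1\<^sub>m 1 :: real mat)"
    by (rule det_four_block_mat_lower_left_zero) auto
  then have U1: "det ?U = 1" by simp
  have "?U * ?N = four_block_mat (1\<^sub>m n * 1\<^sub>m n + ?a * ?b) (1\<^sub>m n * (- ?a) + ?a * 1\<^sub>m 1)
      (0\<^sub>m 1 n * 1\<^sub>m n + 1\<^sub>m 1 * ?b) (0\<^sub>m 1 n * (- ?a) + 1\<^sub>m 1 * 1\<^sub>m 1)"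
    by (rule mult_four_block_mat) auto
  also have "\<dots> = four_block_mat ?M (0\<^sub>m n 1) ?b (1\<^sub>m 1)"
    by (rule arg_cong4[of _ _ _ _ _ _ _ _ four_block_mat])
      (auto intro!: eq_matI simp: scalar_prod_def)
  finally have "det (?U * ?N) = det (four_block_mat ?M (0\<^sub>m n 1) ?b (1\<^sub>m 1))" by simp
  also have "\<dots> = det ?M * det (1\<^sub>m 1 :: real mat)"
    by (rule det_four_block_mat_upper_right_zero) auto
  finally have M: "det ?N = det ?M" using det_mult[OF U N] U1 by simp
  have "?N * ?U = four_block_mat (1\<^sub>m n * 1\<^sub>m n + (- ?a) * 0\<^sub>m 1 n) (1\<^sub>m n * ?a + (- ?a) * 1\<^sub>m 1)
      (?b * 1\<^sub>m n + 1\<^sub>m 1 * 0\<^sub>m 1 n) (?b * ?a + 1\<^sub>m 1 * 1\<^sub>m 1)"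
    by (rule mult_four_block_mat) auto
  also have "\<dots> = four_block_mat (1\<^sub>m n) (0\<^sub>m n 1) ?b ?s"
    by (rule arg_cong4[of _ _ _ _ _ _ _ _ four_block_mat])
      (auto intro!: eq_matI simp: scalar_prod_def atLeast0LessThan mult.commute)
  finally have "det (?N * ?U) = det (four_block_mat (1\<^sub>m n) (0\<^sub>m n 1) ?b ?s)" by simp
  also have "\<dots> = det (1\<^sub>m n :: real mat) * det ?s"
    by (rule det_four_block_mat_upper_right_zero) auto
  finally have "det ?N = det ?s" using det_mult[OF N U] U1 by simp
  with M show ?thesis by (simp add: det_single)
qed

text \<open>The form is semidefinite on a hyperplane, so \<open>g\<close> spans a maximal negative subspace and the
  form is nonnegative on the complement of \<open>g\<close> orthogonal with respect to \<open>X\<close>. Reflecting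
  along \<open>g\<close>, that is multiplying \<open>X\<close> by a matrix \<open>M\<close> of determinant \<open>- 1\<close>, turns the negative
  direction into a positive one and produces a positive semidefinite matrix. Its determinant
  \<open>- det X\<close> is nonnegative.\<close>

lemma det_nonpos_if_negative_direction:
  assumes sym: "sym_mat n X" and i: "i < n" and psd: "psd_on n (- {i}) X"
    and g: "bil n X g g < 0"
  shows "det X \<le> 0"
proof -
  note Xc = sym_mat_carrier[OF sym]
  define q where "q = bil n X g g"
  define u where "u = mulv n X g"
  have q: "q < 0" using g by (simp add: q_def)
  have ux: "(\<Sum>j<n. u j * x j) = bil n X x g" for x
    by (simp add: bil_def u_def mult.commute)
  define U where "U = mat n n (\<lambda>(j, l). u j * u l)"
  define M where "M = mat n n (\<lambda>(j, l). (if j = l then 1 else 0) + (- 2 / q * g j) * u l)"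
  have Mc: "M \<in> carrier_mat n n" by (simp add: M_def)
  have "(\<Sum>j<n. (- 2 / q * g j) * u j) = - 2 / q * (\<Sum>j<n. u j * g j)"
    by (simp add: sum_distrib_left mult_ac)
  also have "\<dots> = - 2" unfolding ux using q by (simp add: q_def)
  finally have detM: "det M = - 1" unfolding M_def det_identity_plus_outer by simp
  have XM: "(X * M) $$ (j, l) = 1 * X $$ (j, l) + (- 2 / q) * U $$ (j, l)" if "j < n" "l < n" for j l
  proof -
    have "(X * M) $$ (j, l) = (\<Sum>p<n. X $$ (j, p) * ((if p = l then 1 else 0) + (- 2 / q * g p) * u l))"
      using that Xc by (simp add: M_def scalar_prod_def atLeast0LessThan)
    also have "\<dots> = (\<Sum>p<n. (if p = l then X $$ (j, p) else 0) + (- 2 / q) * (X $$ (j, p) * g p) * u l)"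
      by (rule sum.cong) (auto simp: algebra_simps)
    also have "\<dots> = X $$ (j, l) + (\<Sum>p<n. (- 2 / q) * (X $$ (j, p) * g p) * u l)"
      unfolding sum.distrib using that by simp
    also have "(\<Sum>p<n. (- 2 / q) * (X $$ (j, p) * g p) * u l) = (- 2 / q) * u j * u l"
    proof -
      have "u j = (\<Sum>p<n. X $$ (j, p) * g p)" by (simp add: u_def mulv_def)
      then show ?thesis by (simp only: sum_distrib_left sum_distrib_right)
    qed
    finally show ?thesis using that by (simp add: U_def)
  qed
  have "psd_on n UNIV (X * M)"
    unfolding psd_on_def
  proof (intro allI impI)
    fix x :: "nat \<Rightarrow> real"
    define s where "s = bil n X x g"
    have gi: "g i \<noteq> 0"
    proof
      assume "g i = 0"
      then have "0 \<le> bil n X g g" using psd by (simp add: psd_on_def)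
      with g show False by simp
    qed
    \<comment> \<open>Removing coordinate \<open>i\<close> by a multiple of \<open>g\<close> moves \<open>x\<close> into the hyperplane where the form
      is nonnegative.\<close>
    define c where "c = (x i) / g i"
    define y where "y = (\<lambda>j. 1 * x j + (- c) * g j)"
    have "y i = 0" using gi by (simp add: y_def c_def)
    then have "0 \<le> bil n X y y" using psd by (simp add: psd_on_def)
    then have "0 \<le> bil n X x x - 2 * c * s + c\<^sup>2 * q"
      unfolding y_def bil_square_lincomb[OF sym] by (simp add: q_def s_def)
    moreover have "q * (bil n X x x - 2 * c * s + c\<^sup>2 * q) = q * bil n X x x - s\<^sup>2 + (c * q - s)\<^sup>2"
      by (simp add: power2_eq_square algebra_simps)
    moreover have "0 \<le> (c * q - s)\<^sup>2" by simp
    moreover have "0 \<le> s\<^sup>2" by simp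
    ultimately have "q * bil n X x x - 2 * s\<^sup>2 \<le> 0"
      using q mult_nonpos_nonneg[of q "bil n X x x - 2 * c * s + c\<^sup>2 * q"] by linarith
    then have "0 \<le> bil n X x x + (- 2 / q) * s\<^sup>2"
      using q by (simp add: field_simps)
    moreover have "bil n U x x = s\<^sup>2"
      using bil_outer[of n U u x x] by (simp add: U_def ux s_def power2_eq_square)
    ultimately show "0 \<le> bil n (X * M) x x"
      using bil_mat_lincomb[OF XM, where x = x and y = x] by simp
  qed
  then have "0 \<le> det (X * M)" using Xc Mc by (intro det_nonneg_if_psd) auto
  then show ?thesis using det_mult[OF Xc Mc] detM by simp
qed

lemma mulv_solvable:
  assumes A: "A \<in> carrier_mat n n" and det: "det A \<noteq> 0"
  obtains y where "\<And>i. i < n \<Longrightarrow> mulv n A y i = b i"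
proof -
  obtain B where B: "B \<in> carrier_mat n n" "A * B = 1\<^sub>m n"
    using det_non_zero_imp_unit[OF A det, of "()"] by (auto simp: Units_def ring_mat_simps)
  define v where "v = B *\<^sub>v vec n b"
  have v: "v \<in> carrier_vec n" using B by (simp add: v_def)
  have "A *\<^sub>v v = vec n b"
    unfolding v_def using assoc_mult_mat_vec[OF A B(1) vec_carrier, of b] B(2) by simp
  then have "mulv n A (\<lambda>j. v $ j) i = b i" if "i < n" for i
    using mult_mat_vec_eq_mulv[OF A v that] that by simp
  then show ?thesis by (rule that)
qed

section \<open>Extreme rays of the closure of order one less than the size\<close>

text \<open>The bound says that a small multiple of \<open>u u\<^sup>T\<close>, where \<open>u\<close> is column \<open>i\<close> of \<open>X\<close>, can be
  subtracted from \<open>X\<close> within the closure. By extremality that rank-one matrix is a multiple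
  of \<open>X\<close>.\<close>

lemma extreme_column_bound:
  assumes n: "2 \<le> n" and ext: "spans_extreme_ray n (k_psd_closure n (n - 1)) X"
    and i: "i < n" and C: "0 < C"
    and bound: "\<And>x j. j < n \<Longrightarrow> x j = 0 \<Longrightarrow> (mulv n X x i)\<^sup>2 \<le> C * bil n X x x"
  obtains b where "0 \<le> b"
    "\<And>j l. j < n \<Longrightarrow> l < n \<Longrightarrow> X $$ (i, j) * X $$ (i, l) = b * X $$ (j, l)"
proof -
  have n0: "0 < n" using n by simp
  have X: "X \<in> k_psd_closure n (n - 1)" using ext by (simp add: spans_extreme_ray_def)
  note Xc = k_psd_closure_carrier[OF X]
  have sym: "sym_mat n X" and psd: "\<And>j. j < n \<Longrightarrow> psd_on n (- {j}) X"
    using X unfolding k_psd_closure_pred_iff[OF n0] by auto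
  define U where "U = mat n n (\<lambda>(j, l). X $$ (i, j) * X $$ (i, l))"
  define Z where "Z = mat n n (\<lambda>(j, l). X $$ (i, j) * X $$ (i, l) / C)"
  define Y where "Y = mat n n (\<lambda>(j, l). X $$ (j, l) - Z $$ (j, l))"
  have bilU: "bil n U x x = (mulv n X x i)\<^sup>2" for x
    using bil_outer[of n U "\<lambda>j. X $$ (i, j)" x x]
    by (simp add: U_def mulv_def power2_eq_square)
  have "bil n Z x x = 1 / C * bil n U x x + 0 * bil n U x x" for x
    by (rule bil_mat_lincomb) (simp add: Z_def U_def)
  then have bilZ: "bil n Z x x = (mulv n X x i)\<^sup>2 / C" for x by (simp add: bilU)
  have "bil n Y x x = 1 * bil n X x x + (- 1) * bil n Z x x" for x
    by (rule bil_mat_lincomb) (simp add: Y_def)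
  then have bilY: "bil n Y x x = bil n X x x - (mulv n X x i)\<^sup>2 / C" for x by (simp add: bilZ)
  have "Z \<in> k_psd_closure n (n - 1)"
    unfolding k_psd_closure_pred_iff[OF n0]
  proof (intro conjI allI impI)
    show "sym_mat n Z" by (intro sym_matI) (simp_all add: Z_def)
    show "psd_on n (- {j}) Z" for j using C by (simp add: psd_on_def bilZ)
  qed
  moreover have "Y \<in> k_psd_closure n (n - 1)"
    unfolding k_psd_closure_pred_iff[OF n0]
  proof (intro conjI allI impI)
    show "sym_mat n Y"
      using sym_mat_index[OF sym] by (intro sym_matI) (auto simp: Y_def Z_def)
    fix j assume j: "j < n"
    show "psd_on n (- {j}) Y"
      unfolding psd_on_def
    proof (intro allI impI)
      fix x :: "nat \<Rightarrow> real" assume "\<forall>l<n. l \<notin> - {j} \<longrightarrow> x l = 0"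
      then have "(mulv n X x i)\<^sup>2 \<le> C * bil n X x x" using j by (intro bound[of j]) auto
      then show "0 \<le> bil n Y x x" unfolding bilY using C by (simp add: field_simps)
    qed
  qed
  moreover have "X = Y + Z" using Xc by (auto simp: Y_def Z_def intro!: eq_matI)
  ultimately obtain b where b: "0 \<le> b" "Z = b \<cdot>\<^sub>m X"
    using ext unfolding spans_extreme_ray_def by blast
  show ?thesis
  proof (rule that[of "b * C"])
    show "0 \<le> b * C" using b C by simp
    fix j l assume jl: "j < n" "l < n"
    have "Z $$ (j, l) = b * X $$ (j, l)" using b(2) jl Xc by simp
    then show "X $$ (i, j) * X $$ (i, l) = b * C * X $$ (j, l)"
      using jl C by (simp add: Z_def field_simps)
  qed
qed

text \<open>Every principal submatrix is an outer product formed from row \<open>p\<close>.\<close>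

lemma product_entries_imp_principal_rank_le_1:
  assumes sym: "sym_mat n X" and p: "p < n" "X $$ (p, p) \<noteq> 0"
    and prod: "\<And>i j. i < n \<Longrightarrow> j < n \<Longrightarrow> X $$ (p, i) * X $$ (p, j) = X $$ (p, p) * X $$ (i, j)"
    and B: "B \<in> principal_submatrices n k X"
  shows "vec_space.rank k B \<le> 1"
proof -
  note Xc = sym_mat_carrier[OF sym]
  obtain I where I: "B = submatrix X I I" "I \<subseteq> {..<n}" "card I = k"
    using B unfolding principal_submatrices_def by blast
  note Bc = principal_submatrix_carrier[OF Xc I(2), folded I(1), unfolded I(3)]
  show ?thesis
  proof (rule vec_space.rank_le_1_product_entries[OF Bc])
    fix a b assume "a < dim_row B" "b < dim_col B"
    then have ab: "a < card I" "b < card I" using Bc I(3) by auto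
    then have lt: "pick I a < n" "pick I b < n" using I(2) pick_in_set_le by blast+
    show "B $$ (a, b) = (X $$ (p, pick I a) / X $$ (p, p)) * X $$ (p, pick I b)"
      unfolding I(1) principal_submatrix_index[OF Xc I(2) ab] using prod[OF lt] p by simp
  qed
qed

text \<open>If \<open>X\<close> itself is semidefinite, Cauchy--Schwarz with a coordinate vector gives the bound needed
  to split off a rank-one matrix.\<close>

lemma extreme_psd_imp_rank_le_1:
  assumes n: "3 \<le> n" and ext: "spans_extreme_ray n (k_psd_closure n (n - 1)) X"
    and psd: "psd_on n UNIV X" and B: "B \<in> principal_submatrices n k X"
  shows "vec_space.rank k B \<le> 1"
proof -
  have X: "X \<in> k_psd_closure n (n - 1)" "X \<noteq> 0\<^sub>m n n" using ext by (auto simp: spans_extreme_ray_def)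
  have sym: "sym_mat n X" using X by (simp add: k_psd_closure_iff)
  have k: "2 \<le> n - 1" "n - 1 \<le> n" "2 \<le> n" using n by auto
  obtain p where p: "p < n" "0 < X $$ (p, p)"
    using k_psd_closure_pos_diag[OF X k(1,2)] by blast
  have bound: "(mulv n X x p)\<^sup>2 \<le> X $$ (p, p) * bil n X x x" for x
    using psd_on_Cauchy_Schwarz[OF sym psd, of "unit_fun p" x] p
    by (simp add: bil_unit_left mulv_unit)
  obtain b where b: "\<And>i j. i < n \<Longrightarrow> j < n \<Longrightarrow> X $$ (p, i) * X $$ (p, j) = b * X $$ (i, j)"
    by (rule extreme_column_bound[OF k(3) ext p]) (rule bound, blast)
  have "b = X $$ (p, p)" using b[OF p(1,1)] p(2) by simp
  with b show ?thesis
    by (intro product_entries_imp_principal_rank_le_1[OF sym p(1) _ _ B]) (use p in auto)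
qed

text \<open>The hypotheses say that, outside row \<open>i\<close>, column \<open>i\<close> is the image of a vector \<open>w\<close> of the
  hyperplane where coordinate \<open>i\<close> vanishes. Cauchy--Schwarz against \<open>w\<close> bounds the pairing with
  column \<open>i\<close> on that hyperplane, and against the coordinate vector on all the others. Hence
  \<open>u u\<^sup>T = b X\<close> for the column \<open>u\<close> and some \<open>b \<ge> 0\<close>. If \<open>b > 0\<close>, this exhibits \<open>X\<close> as
  semidefinite; if \<open>b = 0\<close>, the column is zero and the form lives on the hyperplane.\<close>

lemma extreme_column_dependent_imp_psd:
  assumes n: "2 \<le> n" and ext: "spans_extreme_ray n (k_psd_closure n (n - 1)) X"
    and i: "i < n" and wi: "w i = 0"
    and w: "\<And>j. j < n \<Longrightarrow> j \<noteq> i \<Longrightarrow> mulv n X w j = X $$ (j, i)"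
  shows "psd_on n UNIV X"
proof -
  have n0: "0 < n" using n by simp
  have X: "X \<in> k_psd_closure n (n - 1)" using ext by (simp add: spans_extreme_ray_def)
  have sym: "sym_mat n X" and psd: "\<And>j. j < n \<Longrightarrow> psd_on n (- {j}) X"
    using X unfolding k_psd_closure_pred_iff[OF n0] by auto
  have nonneg: "0 \<le> bil n X x x" if "j < n" "x j = 0" for x j
    using psd[OF that(1)] that(2) by (simp add: psd_on_def)
  \<comment> \<open>Dominates the two Cauchy--Schwarz constants; the summand one makes it positive.\<close>
  define C where "C = \<bar>X $$ (i, i)\<bar> + bil n X w w + 1"
  have ww: "0 \<le> bil n X w w" by (rule nonneg[of i w, OF i wi])
  then have C: "0 < C" by (simp add: C_def)
  have bound: "(mulv n X x i)\<^sup>2 \<le> C * bil n X x x" if j: "j < n" "x j = 0" for x j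
  proof -
    have xx: "0 \<le> bil n X x x" by (rule nonneg[of j x, OF j])
    have "(mulv n X x i)\<^sup>2 \<le> D * bil n X x x" if D: "D = (if j = i then bil n X w w else X $$ (i, i))" for D
    proof (cases "j = i")
      case True
      have "bil n X x w = (\<Sum>l<n. x l * X $$ (l, i))"
        unfolding bil_def by (rule sum.cong) (use w j True in auto)
      also have "\<dots> = mulv n X x i"
        unfolding mulv_def by (rule sum.cong) (use sym_mat_index[OF sym i] in auto)
      finally have "mulv n X x i = bil n X w x" using bil_sym[OF sym] by simp
      then show ?thesis
        using psd_on_Cauchy_Schwarz[OF sym psd[OF i], of w x] wi j True D by simp
    next
      case False
      then show ?thesis
        using psd_on_Cauchy_Schwarz[OF sym psd[OF j(1)], of "unit_fun i" x] j D i
        by (simp add: bil_unit_left mulv_unit unit_fun_def)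
    qed
    also have "(if j = i then bil n X w w else X $$ (i, i)) * bil n X x x \<le> C * bil n X x x"
      by (rule mult_right_mono[OF _ xx]) (use ww in \<open>auto simp: C_def\<close>)
    finally show ?thesis by simp
  qed
  obtain b where b: "0 \<le> b"
    "\<And>j l. j < n \<Longrightarrow> l < n \<Longrightarrow> X $$ (i, j) * X $$ (i, l) = b * X $$ (j, l)"
  proof (rule extreme_column_bound[OF n ext i C])
    fix x :: "nat \<Rightarrow> real" and j assume "j < n" "x j = 0"
    then show "(mulv n X x i)\<^sup>2 \<le> C * bil n X x x" by (rule bound[of j x])
  qed blast
  show ?thesis
    unfolding psd_on_def
  proof (intro allI impI)
    fix x :: "nat \<Rightarrow> real"
    show "0 \<le> bil n X x x"
    proof (cases "b = 0")
      case True
      have col: "X $$ (i, j) = 0" if "j < n" for j using b(2)[OF that that] True by simp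
      then have xi: "bil n X x (unit_fun i) = 0"
        by (simp add: bil_unit_right[OF sym i] mulv_def)
      define y where "y = (\<lambda>j. 1 * x j + (- x i) * unit_fun i j)"
      have "bil n X y y = bil n X x x"
        unfolding y_def bil_square_lincomb[OF sym] using xi col[OF i] i by (simp add: bil_units)
      moreover have "0 \<le> bil n X y y" by (rule nonneg[of i y, OF i]) (simp add: y_def unit_fun_def)
      ultimately show ?thesis by simp
    next
      case False
      define U where "U = mat n n (\<lambda>(j, l). X $$ (i, j) * X $$ (i, l))"
      have "bil n X x x = 1 / b * bil n U x x + 0 * bil n U x x"
        by (rule bil_mat_lincomb) (use False b(2) in \<open>simp add: U_def\<close>)
      moreover have "bil n U x x = (mulv n X x i)\<^sup>2"
        using bil_outer[of n U "\<lambda>j. X $$ (i, j)" x x]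
        by (simp add: U_def mulv_def power2_eq_square)
      ultimately show ?thesis using b(1) by simp
    qed
  qed
qed

text \<open>The dependence excluded by \<open>extreme_column_dependent_imp_psd\<close> could come from two sources: a
  kernel vector of \<open>X\<close>, scaled so that column \<open>i\<close> is a combination of the others, or an
  invertible principal submatrix, in which the linear system can simply be solved.\<close>

lemma extreme_not_psd_imp_singular_principal:
  assumes n: "2 \<le> n" and ext: "spans_extreme_ray n (k_psd_closure n (n - 1)) X"
    and not_psd: "\<not> psd_on n UNIV X"
  shows "det X \<noteq> 0"
    and "i < n \<Longrightarrow> det (submatrix X ({..<n} - {i}) ({..<n} - {i})) = 0"
proof -
  have X: "X \<in> k_psd_closure n (n - 1)" using ext by (simp add: spans_extreme_ray_def)
  note Xc = k_psd_closure_carrier[OF X]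
  have indep: False if "i < n" "w i = 0" "\<And>j. j < n \<Longrightarrow> j \<noteq> i \<Longrightarrow> mulv n X w j = X $$ (j, i)" for i w
    using extreme_column_dependent_imp_psd[OF n ext that] not_psd by blast
  show "det X \<noteq> 0"
  proof
    assume "det X = 0"
    then obtain z i where z: "i < n" "z i \<noteq> 0" "\<And>j. j < n \<Longrightarrow> mulv n X z j = 0"
      unfolding det_zero_iff_mulv[OF Xc] by blast
    define w where "w = (\<lambda>j. 1 * unit_fun i j + (- 1 / z i) * z j)"
    show False
    proof (rule indep[of i w, OF z(1)])
      show "w i = 0" using z(2) by (simp add: w_def unit_fun_def)
      show "mulv n X w j = X $$ (j, i)" if "j < n" for j
        unfolding w_def mulv_lincomb using z that by (simp add: mulv_unit)
    qed
  qed
  show "det (submatrix X ({..<n} - {i}) ({..<n} - {i})) = 0" if i: "i < n"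
  proof (rule ccontr)
    let ?I = "{..<n} - {i}"
    have I: "?I \<subseteq> {..<n}" by blast
    assume "det (submatrix X ?I ?I) \<noteq> 0"
    then obtain y where y: "\<And>a. a < card ?I \<Longrightarrow> mulv (card ?I) (submatrix X ?I ?I) y a = X $$ (pick ?I a, i)"
      using mulv_solvable[OF principal_submatrix_carrier[OF Xc I], where b = "\<lambda>a. X $$ (pick ?I a, i)"] by blast
    show False
    proof (rule indep[of i "zero_extend ?I y", OF i])
      show "zero_extend ?I y i = 0" by (simp add: zero_extend_def)
      fix j assume "j < n" "j \<noteq> i"
      then have "j \<in> pick ?I ` {..<card ?I}"
        using bij_betw_pick[of ?I] by (simp add: bij_betw_def)
      then obtain a where "a < card ?I" "j = pick ?I a" by blast
      then show "mulv n X (zero_extend ?I y) j = X $$ (j, i)"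
        using y mulv_submatrix[OF Xc I] by metis
    qed
  qed
qed

text \<open>Let \<open>B\<close> be the principal submatrix and \<open>u\<close> the deleted column. Since \<open>B\<close> is semidefinite,
  a kernel vector of \<open>B + u u\<^sup>T\<close> is killed by \<open>B\<close> and by \<open>u\<close>, hence by all of \<open>X\<close>. So
  \<open>B + u u\<^sup>T\<close> is invertible, and \<open>B\<close> loses at most one in rank against it.\<close>

lemma rank_singular_principal_submatrix:
  assumes sym: "sym_mat n X" and i: "i < n" and psd: "psd_on n (- {i}) X"
    and det: "det X \<noteq> 0" and sing: "det (submatrix X ({..<n} - {i}) ({..<n} - {i})) = 0"
  shows "vec_space.rank (n - 1) (submatrix X ({..<n} - {i}) ({..<n} - {i})) = n - 2"
proof -
  let ?I = "{..<n} - {i}"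
  let ?B = "submatrix X ?I ?I"
  note Xc = sym_mat_carrier[OF sym]
  have I: "?I \<subseteq> {..<n}" by blast
  have card: "card ?I = n - 1" using i by simp
  note B = principal_submatrix_carrier[OF Xc I, unfolded card]
  define u where "u a = X $$ (i, pick ?I a)" for a
  define C where "C = mat (n - 1) (n - 1) (\<lambda>(a, b). u a * u b)"
  have C: "C \<in> carrier_mat (n - 1) (n - 1)" by (simp add: C_def)
  have "det (?B + C) \<noteq> 0"
  proof
    assume "det (?B + C) = 0"
    then obtain w a where w: "a < n - 1" "w a \<noteq> 0" "\<And>b. b < n - 1 \<Longrightarrow> mulv (n - 1) (?B + C) w b = 0"
      using det_zero_iff_mulv[of "?B + C" "n - 1"] B C by auto
    define x where "x = zero_extend ?I w"
    have xi: "x i = 0" by (simp add: x_def zero_extend_def)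
    have "0 = bil (n - 1) (?B + C) w w" using w(3) by (simp add: bil_def)
    also have "\<dots> = 1 * bil (n - 1) ?B w w + 1 * bil (n - 1) C w w"
      by (rule bil_mat_lincomb) (use B C in auto)
    also have "bil (n - 1) ?B w w = bil n X x x"
      using bil_submatrix[OF Xc I, of w w] by (simp only: card x_def)
    also have "bil (n - 1) C w w = (mulv n X x i)\<^sup>2"
    proof -
      have "mulv n X x i = (\<Sum>b<n - 1. u b * w b)"
        unfolding mulv_def x_def u_def using sum_extend[OF I, of "\<lambda>j. X $$ (i, j)" w] by (simp only: card)
      then show ?thesis
        using bil_outer[of "n - 1" C u w w] by (simp add: C_def power2_eq_square)
    qed
    finally have sum0: "bil n X x x + (mulv n X x i)\<^sup>2 = 0" by simp
    moreover have xx: "0 \<le> bil n X x x" using psd xi by (simp add: psd_on_def)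
    moreover have "0 \<le> (mulv n X x i)\<^sup>2" by simp
    ultimately have "bil n X x x = 0" "mulv n X x i = 0" by (simp_all add: add_nonneg_eq_0_iff)
    then have "mulv n X x j = 0" if "j < n" for j
      using psd_on_isotropic[OF sym psd, of x j] xi that by (cases "j = i") auto
    moreover have "pick ?I a < n" using pick_in_set_le[of a ?I] w(1) card by simp
    moreover have "x (pick ?I a) \<noteq> 0" using w(1,2) card by (simp add: x_def extend_pick)
    ultimately have "det X = 0" unfolding det_zero_iff_mulv[OF Xc] by blast
    with det show False by simp
  qed
  then have "n - 1 = vec_space.rank (n - 1) (?B + C)"
    using vec_space.low_rank_det_zero[of "?B + C" "n - 1"] B C by simp
  also have "\<dots> \<le> vec_space.rank (n - 1) ?B + vec_space.rank (n - 1) C"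
    by (rule vec_space.rank_subadditive[OF B C])
  also have "vec_space.rank (n - 1) C \<le> 1"
    by (rule vec_space.rank_le_1_product_entries[OF C, of u u]) (simp add: C_def)
  finally have "n - 1 \<le> vec_space.rank (n - 1) ?B + 1" by simp
  moreover have "vec_space.rank (n - 1) ?B < n - 1"
    by (rule vec_space.det_zero_low_rank[OF B sing])
  ultimately show ?thesis by linarith
qed

section \<open>Singular principal submatrices and a negative determinant\<close>

text \<open>Each singular principal submatrix yields \<open>v i\<close> with coordinate \<open>i\<close> zero and \<open>X (v i)\<close> equal to
  the coordinate vector \<open>i\<close>. This vector is isotropic for \<open>X\<close>, hence for each summand \<open>Y\<close>, so
  \<open>Y (v i)\<close> is \<open>d i\<close> times the same coordinate vector. As the \<open>v i\<close> are the columns of the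
  inverse of \<open>X\<close>, this means that \<open>Y\<close> is \<open>X\<close> with column \<open>j\<close> scaled by \<open>d j\<close>. Symmetry of \<open>Y\<close>
  forces \<open>d i = d j\<close> wherever \<open>X\<close> has a nonzero entry. Were \<open>d\<close> not constant, \<open>X\<close> would
  split into two diagonal blocks, each inside a principal submatrix of the closure; then \<open>X\<close>
  would be semidefinite, against its negative determinant.\<close>

lemma singular_principals_imp_extreme:
  assumes n: "3 \<le> n" and X: "X \<in> k_psd_closure n (n - 1)" and neg: "det X < 0"
    and sing: "\<And>i. i < n \<Longrightarrow> det (submatrix X ({..<n} - {i}) ({..<n} - {i})) = 0"
  shows "spans_extreme_ray n (k_psd_closure n (n - 1)) X"
proof -
  have n0: "0 < n" and k: "2 \<le> n - 1" "n - 1 \<le> n" using n by auto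
  note Xc = k_psd_closure_carrier[OF X]
  have sym: "sym_mat n X" and psdX: "\<And>j. j < n \<Longrightarrow> psd_on n (- {j}) X"
    using X unfolding k_psd_closure_pred_iff[OF n0] by auto
  have X0: "X \<noteq> 0\<^sub>m n n"
    using neg det_zero[OF n0, where 'a = real] by auto
  have "\<exists>v. v i = 0 \<and> (\<forall>j<n. mulv n X v j = unit_fun i j)" if i: "i < n" for i
  proof -
    let ?I = "{..<n} - {i}"
    have I: "?I \<subseteq> {..<n}" by blast
    obtain x where x: "\<forall>j. j \<notin> ?I \<longrightarrow> x j = 0" "\<exists>j\<in>?I. x j \<noteq> 0" "\<forall>j\<in>?I. mulv n X x j = 0"
      using sing[OF i] unfolding det_submatrix_zero_iff[OF Xc I] by blast
    have c: "mulv n X x i \<noteq> 0"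
    proof
      assume "mulv n X x i = 0"
      then have "\<forall>j<n. mulv n X x j = 0" using x(3) by auto
      moreover have "\<exists>j<n. x j \<noteq> 0" using x(2) by auto
      ultimately have "det X = 0" unfolding det_zero_iff_mulv[OF Xc] by blast
      with neg show False by simp
    qed
    define v where "v = (\<lambda>j. (1 / mulv n X x i) * x j + 0 * x j)"
    have "v i = 0" using x(1) by (simp add: v_def)
    moreover have "mulv n X v j = unit_fun i j" if "j < n" for j
      unfolding v_def mulv_lincomb using x(3) c that by (simp add: unit_fun_def)
    ultimately show ?thesis by blast
  qed
  then obtain v where vi: "\<And>i. i < n \<Longrightarrow> v i i = 0"
    and v: "\<And>i j. i < n \<Longrightarrow> j < n \<Longrightarrow> mulv n X (v i) j = unit_fun i j"
    by metis
  have pair: "bil n X (v i) y = y i" if i: "i < n" for i y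
  proof -
    have "bil n X (v i) y = bil n X y (v i)" by (rule bil_sym[OF sym])
    also have "\<dots> = (\<Sum>j<n. if j = i then y j else 0)"
      unfolding bil_def by (rule sum.cong) (use v[OF i] in \<open>auto simp: unit_fun_def\<close>)
    finally show ?thesis using i by simp
  qed
  show ?thesis
  proof (rule spans_extreme_rayI[OF X X0])
    fix Y Z assume Y: "Y \<in> k_psd_closure n (n - 1)" and Z: "Z \<in> k_psd_closure n (n - 1)"
      and XYZ: "X = Y + Z"
    note Yc = k_psd_closure_carrier[OF Y] and Zc = k_psd_closure_carrier[OF Z]
    have symY: "sym_mat n Y" and psdY: "\<And>j. j < n \<Longrightarrow> psd_on n (- {j}) Y"
      and psdZ: "\<And>j. j < n \<Longrightarrow> psd_on n (- {j}) Z"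
      using Y Z unfolding k_psd_closure_pred_iff[OF n0] by auto
    define d where "d i = mulv n Y (v i) i" for i
    have Yv: "mulv n Y (v i) j = d i * unit_fun i j" if ij: "i < n" "j < n" for i j
    proof (cases "j = i")
      case True
      then show ?thesis by (simp add: d_def unit_fun_def)
    next
      case False
      have "bil n X (v i) (v i) = 1 * bil n Y (v i) (v i) + 1 * bil n Z (v i) (v i)"
        by (rule bil_mat_lincomb) (use XYZ Yc Zc in auto)
      moreover have "bil n X (v i) (v i) = 0" using pair[OF ij(1)] vi[OF ij(1)] by simp
      moreover have "0 \<le> bil n Y (v i) (v i)" "0 \<le> bil n Z (v i) (v i)"
        using psdY[OF ij(1)] psdZ[OF ij(1)] vi[OF ij(1)] by (auto simp: psd_on_def)
      ultimately have "bil n Y (v i) (v i) = 0" by simp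
      then have "mulv n Y (v i) j = 0"
        using psd_on_isotropic[OF symY psdY[OF ij(1)], of "v i" j] vi[OF ij(1)] ij False by auto
      then show ?thesis using False by (simp add: unit_fun_def)
    qed
    have YX: "Y $$ (i, j) = d j * X $$ (i, j)" if ij: "i < n" "j < n" for i j
    proof -
      \<comment> \<open>The column difference is \<open>X y\<close> for some \<open>y\<close>, and pairing with the \<open>v l\<close> reads off the
        coordinates of \<open>y\<close>.\<close>
      obtain y where y: "\<And>l. l < n \<Longrightarrow> mulv n X y l = Y $$ (l, j) - d j * X $$ (l, j)"
        using mulv_solvable[OF Xc, where b = "\<lambda>l. Y $$ (l, j) - d j * X $$ (l, j)"] neg by auto
      have "y l = 0" if l: "l < n" for l
      proof -
        have "y l = bil n X (v l) y" using pair[OF l] by simp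
        also have "\<dots> = (\<Sum>p<n. v l p * (Y $$ (p, j) - d j * X $$ (p, j)))"
          unfolding bil_def using y by simp
        also have "\<dots> = (\<Sum>p<n. v l p * Y $$ (p, j)) - d j * (\<Sum>p<n. v l p * X $$ (p, j))"
          by (simp add: sum_subtractf sum_distrib_left algebra_simps)
        also have "(\<Sum>p<n. v l p * Y $$ (p, j)) = mulv n Y (v l) j"
          unfolding mulv_def by (rule sum.cong) (use sym_mat_index[OF symY ij(2)] in auto)
        also have "(\<Sum>p<n. v l p * X $$ (p, j)) = mulv n X (v l) j"
          unfolding mulv_def by (rule sum.cong) (use sym_mat_index[OF sym ij(2)] in auto)
        finally show ?thesis using Yv[OF l ij(2)] v[OF l ij(2)] by (simp add: unit_fun_def split: if_splits)
      qed
      then have "mulv n X y i = 0" by (simp add: mulv_def)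
      then show ?thesis using y[OF ij(1)] by simp
    qed
    have conn: "d i = d j" if ij: "i < n" "j < n" "X $$ (i, j) \<noteq> 0" for i j
      using YX[OF ij(1,2)] YX[OF ij(2,1)] sym_mat_index[OF sym ij(1,2)]
        sym_mat_index[OF symY ij(1,2)] ij(3) by simp
    have const: "d i = d 0" if i: "i < n" for i
    proof (rule ccontr)
      assume ne: "d i \<noteq> d 0"
      have "psd_on n UNIV X"
        unfolding psd_on_def
      proof (intro allI impI)
        fix x :: "nat \<Rightarrow> real"
        \<comment> \<open>Both pieces have a zero coordinate: \<open>i\<close> for the first, \<open>0\<close> for the second.\<close>
        define y where "y j = (if d j = d 0 then x j else 0)" for j
        define z where "z j = (if d j = d 0 then 0 else x j)" for j
        have "mulv n X z j = 0" if "j < n" "d j = d 0" for j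
          unfolding mulv_def
        proof (rule sum.neutral, rule ballI)
          fix l assume "l \<in> {..<n}"
          then show "X $$ (j, l) * z l = 0"
            using conn[of j l] that by (cases "X $$ (j, l) = 0") (simp_all add: z_def)
        qed
        then have yz: "bil n X y z = 0"
          unfolding bil_def by (intro sum.neutral) (auto simp: y_def)
        have "bil n X x x = bil n X (\<lambda>j. 1 * y j + 1 * z j) (\<lambda>j. 1 * y j + 1 * z j)"
          by (rule bil_cong) (auto simp: y_def z_def)
        also have "\<dots> = bil n X y y + bil n X z z"
          unfolding bil_square_lincomb[OF sym] using yz by simp
        also have "0 \<le> bil n X y y"
          using psdX[OF i] ne by (simp add: psd_on_def y_def)
        then have "0 \<le> bil n X y y + bil n X z z"
          using psdX[OF n0] by (simp add: psd_on_def z_def)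
        finally show "0 \<le> bil n X x x" .
      qed
      from det_nonneg_if_psd[OF Xc this] neg show False by simp
    qed
    have YX0: "Y $$ (i, j) = d 0 * X $$ (i, j)" if "i < n" "j < n" for i j
      using YX[OF that] unfolding const[OF that(2)] .
    have "Y = d 0 \<cdot>\<^sub>m X"
      using Xc Yc by (intro eq_matI) (auto simp: YX0)
    moreover obtain p where p: "p < n" "0 < X $$ (p, p)"
      using k_psd_closure_pos_diag[OF X X0 k] by blast
    have "0 \<le> d 0 * X $$ (p, p)"
      using k_psd_closure_minors(1)[OF Y k p(1,1)] YX0[OF p(1,1)] by simp
    then have "0 \<le> d 0" using p(2) by (simp add: zero_le_mult_iff)
    ultimately show "\<exists>a\<ge>0. Y = a \<cdot>\<^sub>m X" by blast
  qed
qed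

lemma principal_submatrices_pred:
  assumes "0 < n"
  shows "principal_submatrices n (n - 1) X = {submatrix X ({..<n} - {i}) ({..<n} - {i}) | i. i < n}"
  unfolding principal_submatrices_def card_pred_subset_iff[OF assms] by auto

section \<open>Extreme rays and ranks\<close>

theorem theorem1:
  fixes n :: nat and X :: "real mat"
  assumes "sym_mat n X"
  shows
    "(\<forall>k. 2 \<le> k \<and> k \<le> n \<longrightarrow>
        (\<forall>B \<in> principal_submatrices n k X. vec_space.rank k B = 1 \<and> psd_mat k B) \<longrightarrow>
        spans_extreme_ray n (k_psd_closure n k) X)
   \<and> (2 \<le> n \<longrightarrow>
        (spans_extreme_ray n (k_psd_closure n 2) X \<longleftrightarrow>
          X \<noteq> 0\<^sub>m n n \<and>
          (\<forall>B \<in> principal_submatrices n 2 X. vec_space.rank 2 B \<le> 1 \<and> psd_mat 2 B)))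
   \<and> (3 \<le> n \<longrightarrow>
        (spans_extreme_ray n (k_psd_closure n (n - 1)) X \<longleftrightarrow>
          (\<forall>B \<in> principal_submatrices n (n - 1) X. psd_mat (n - 1) B) \<and>
          (X \<noteq> 0\<^sub>m n n \<and>
             (\<forall>B \<in> principal_submatrices n (n - 1) X. vec_space.rank (n - 1) B \<le> 1)
           \<or> (\<forall>B \<in> principal_submatrices n (n - 1) X. vec_space.rank (n - 1) B = n - 2) \<and>
             det X < 0)))"
proof (intro conjI impI allI)
  note Xc = sym_mat_carrier[OF assms]
  have in_closure: "X \<in> k_psd_closure n k \<longleftrightarrow> (\<forall>B \<in> principal_submatrices n k X. psd_mat k B)" for k
    using assms by (simp add: k_psd_closure_def)
  have rank_one: "spans_extreme_ray n (k_psd_closure n k) X"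
    if k: "2 \<le> k" "k \<le> n" and X0: "X \<noteq> 0\<^sub>m n n" and X: "X \<in> k_psd_closure n k"
      and rank: "\<forall>B \<in> principal_submatrices n k X. vec_space.rank k B \<le> 1" for k
    by (rule rank_one_minors_imp_extreme[OF k X X0])
      (rule principal_rank_le_1_imp_minors[OF assms k rank])
  {
    fix k assume k: "2 \<le> k \<and> k \<le> n"
      and H: "\<forall>B \<in> principal_submatrices n k X. vec_space.rank k B = 1 \<and> psd_mat k B"
    have "X \<noteq> 0\<^sub>m n n"
    proof
      assume X0: "X = 0\<^sub>m n n"
      have I: "{..<k} \<subseteq> {..<n}" using k by auto
      have "submatrix X {..<k} {..<k} = 0\<^sub>m k k"
      proof (rule eq_matI)
        fix a b assume "a < dim_row (0\<^sub>m k k :: real mat)" "b < dim_col (0\<^sub>m k k :: real mat)"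
        then have ab: "a < k" "b < k" by auto
        then have "pick {..<k} a < n" "pick {..<k} b < n"
          using I pick_in_set_le[of _ "{..<k}"] by fastforce+
        then show "submatrix X {..<k} {..<k} $$ (a, b) = 0\<^sub>m k k $$ (a, b)"
          using principal_submatrix_index[OF Xc I, of a b] ab X0 by simp
      qed (use principal_submatrix_carrier[OF Xc I] in auto)
      moreover have "submatrix X {..<k} {..<k} \<in> principal_submatrices n k X"
        using I by (auto simp: principal_submatrices_def)
      ultimately show False using H vec_space.rank_0I[of k k, where 'a = real] by auto
    qed
    then show "spans_extreme_ray n (k_psd_closure n k) X"
      using rank_one[of k] H k in_closure by auto
  }
  {
    assume n: "2 \<le> n"
    show "spans_extreme_ray n (k_psd_closure n 2) X \<longleftrightarrow> X \<noteq> 0\<^sub>m n n \<and>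
        (\<forall>B \<in> principal_submatrices n 2 X. vec_space.rank 2 B \<le> 1 \<and> psd_mat 2 B)"
    proof
      assume ext: "spans_extreme_ray n (k_psd_closure n 2) X"
      then have "X \<in> k_psd_closure n 2" "X \<noteq> 0\<^sub>m n n" by (auto simp: spans_extreme_ray_def)
      then show "X \<noteq> 0\<^sub>m n n \<and>
          (\<forall>B \<in> principal_submatrices n 2 X. vec_space.rank 2 B \<le> 1 \<and> psd_mat 2 B)"
        using minors_imp_rank_le_1_2x2[OF assms extreme_2_imp_minors[OF n ext]] in_closure by blast
    next
      assume "X \<noteq> 0\<^sub>m n n \<and>
          (\<forall>B \<in> principal_submatrices n 2 X. vec_space.rank 2 B \<le> 1 \<and> psd_mat 2 B)"
      then show "spans_extreme_ray n (k_psd_closure n 2) X"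
        using rank_one[of 2] n in_closure by blast
    qed
  }
  {
    assume n: "3 \<le> n"
    then have n0: "0 < n" and n2: "2 \<le> n" and k: "2 \<le> n - 1" "n - 1 \<le> n" by auto
    let ?S = "\<lambda>i. submatrix X ({..<n} - {i}) ({..<n} - {i})"
    have all_principal: "(\<forall>B \<in> principal_submatrices n (n - 1) X. P B) \<longleftrightarrow> (\<forall>i<n. P (?S i))" for P
      unfolding principal_submatrices_pred[OF n0] by auto
    show "spans_extreme_ray n (k_psd_closure n (n - 1)) X \<longleftrightarrow>
          (\<forall>B \<in> principal_submatrices n (n - 1) X. psd_mat (n - 1) B) \<and>
          (X \<noteq> 0\<^sub>m n n \<and>
             (\<forall>B \<in> principal_submatrices n (n - 1) X. vec_space.rank (n - 1) B \<le> 1)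
           \<or> (\<forall>B \<in> principal_submatrices n (n - 1) X. vec_space.rank (n - 1) B = n - 2) \<and>
             det X < 0)" (is "?E \<longleftrightarrow> ?P \<and> (?a \<or> ?b)")
    proof
      assume ext: ?E
      then have X: "X \<in> k_psd_closure n (n - 1)" "X \<noteq> 0\<^sub>m n n" by (auto simp: spans_extreme_ray_def)
      have "?a \<or> ?b"
      proof (cases "psd_on n UNIV X")
        case True
        then show ?thesis using extreme_psd_imp_rank_le_1[OF n ext] X(2) by blast
      next
        case False
        note det = extreme_not_psd_imp_singular_principal[OF n2 ext False]
        have psd: "psd_on n (- {i}) X" if "i < n" for i
          using X(1) that unfolding k_psd_closure_pred_iff[OF n0] by blast
        obtain g where "bil n X g g < 0" using False by (auto simp: psd_on_def not_le)
        then have "det X \<le> 0" by (rule det_nonpos_if_negative_direction[OF assms n0 psd[OF n0]])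
        moreover have "vec_space.rank (n - 1) (?S i) = n - 2" if "i < n" for i
          by (rule rank_singular_principal_submatrix[OF assms that psd[OF that] det(1) det(2)[OF that]])
        ultimately show ?thesis using det(1) unfolding all_principal by auto
      qed
      then show "?P \<and> (?a \<or> ?b)" using X(1) in_closure by blast
    next
      assume H: "?P \<and> (?a \<or> ?b)"
      then have X: "X \<in> k_psd_closure n (n - 1)" using in_closure by blast
      from H consider ?a | ?b by blast
      then show ?E
      proof cases
        case 1
        then show ?thesis using rank_one[OF k _ X] by blast
      next
        case 2
        have "det (?S i) = 0" if i: "i < n" for i
        proof -
          have "?S i \<in> carrier_mat (n - 1) (n - 1)"
            using principal_submatrix_carrier[OF Xc, of "{..<n} - {i}"] i by simp
          moreover have "vec_space.rank (n - 1) (?S i) \<noteq> n - 1"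
            using 2 i n unfolding all_principal by auto
          ultimately show ?thesis using vec_space.low_rank_det_zero by blast
        qed
        with 2 show ?thesis using singular_principals_imp_extreme[OF n X] by blast
      qed
    qed
  }
qed

end
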